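(* Let $\Theta$ be a compatible collection of irreducible Pisot substitutions on $\mathcal A=\{1,\dots,d\}$, with enveloping random substitution $\vartheta$. For all $a\in\mathcal A$, $$\bigcup_{\boldsymbol\theta\in\Theta^{\mathbb N}}\mathcal R_{\boldsymbol\theta,a}=\mathcal R_{\vartheta,a}.$$
   Context: Let $\mathcal A^+$ be the set of non-empty finite words over $\mathcal A$, $|u|_i$ the number of occurrences of $i$ in $u$, $\psi(u)=(|u|_1,\dots,|u|_d)^T$, and $x_{[1,n]}=x_1\cdots x_n$ (empty if $n=0$). $S$ is the left shift on sequence spaces; the shift-orbit of $x$ is $\{S^n x:n\ge 0\}$. A (deterministic) substitution is a map $\theta\colon\mathcal A\to\mathcal A^+$, extended to words and sequences by concatenation; its matrix is $M_{i,j}=|\theta(j)|_i$. A non-empty set $\Theta$ of substitutions is compatible if all have the same matrix $M$ (so $\Theta$ is finite). Throughout, $M$ is primitive; the elements of $\Theta$ are irreducible Pisot if the Perron–Frobenius eigenvalue $\lambda$ of $M$ is a Pisot number and the characteristic polynomial of $M$ is irreducible over $\mathbb Z$. $\mathbf L,\mathbf R$ are left and right Perron–Frobenius eigenvectors of $M$; $\mathbb H\subset\mathbb R^d$ is the hyperplane orthogonal to $\mathbf L$; $\pi$ is the linear projection along $\mathbf R$ onto $\mathbb H$. For a sequence $w\in\mathcal A^{\mathbb N}$: $\mathcal S_a(w)=\{\psi(w_{[1,n]}):n\ge0,\ w_{n+1}=a\}$ and $\mathcal R_a(w)=\overline{\pi(\mathcal S_a(w))}$. S-adic subtiles: for $\boldsymbol\theta=(\theta_n)_{n\in\mathbb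 N}\in\Theta^{\mathbb N}$, a letter sequence $\mathbf a=(a_n)_{n\in\mathbb N}$ is adapted to $\boldsymbol\theta$ if $\theta_n(a_n)$ starts with $a_{n-1}$ for all $n\ge2$. Then $u(\boldsymbol\theta,\mathbf a)\in\mathcal A^{\mathbb N}$ is the unique sequence having $\theta_1\circ\cdots\circ\theta_n(a_n)$ as a prefix for all $n$. Put $\mathcal R_{\boldsymbol\theta,a}=\mathcal R_a(u(\boldsymbol\theta,\mathbf a))$, which does not depend on the choice of the adapted sequence $\mathbf a$. The enveloping random substitution of $\Theta$ is the set-valued map $\vartheta(a)=\{\theta(a):\theta\in\Theta\}$, $a\in\mathcal A$. For a word (or infinite sequence) $u=u_1u_2\cdots$ put $\vartheta(u)=\{v_1v_2\cdots:v_i\in\vartheta(u_i)\}$; $\vartheta(X)=\bigcup_{x\in X}\vartheta(x)$; powers $\vartheta^n$ are defined by iteration. $X_\vartheta$ is the set of $x\in\mathcal A^{\mathbb N}$ all of whose finite subwords are subwords of some element of $\vartheta^k(b)$, $b\in\mathcal A$, $k\in\mathbb N$; $X_\vartheta^\infty=\bigcap_{n\ge0}\vartheta^n(X_\vartheta)$. The subtile $\mathcal R_{\vartheta,a}$ is $\mathcal R_a(w)$ for any $w\in X_\vartheta^\infty$ with dense shift-orbit in $X_\vartheta$ (such $w$ exist, and the set does not depend on the choice of $w$). *)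

theory Defs
  imports "HOL-Analysis.Analysis" "HOL-Library.Sublist"
begin

text \<open>
  The alphabet is a finite type \<open>'a\<close>, so that \<open>d = CARD('a)\<close> and \<open>\<real>\<^sup>d\<close> is \<open>real^'a\<close>.
  Sequences are functions on \<open>nat\<close> and are numbered from \<open>0\<close>: \<open>w n\<close> is the letter
  \<open>w\<^bsub>n+1\<^esub>\<close>, and likewise \<open>\<theta> n\<close> and \<open>\<alpha> n\<close> are \<open>\<theta>\<^bsub>n+1\<^esub>\<close> and \<open>a\<^bsub>n+1\<^esub>\<close>.
\<close>

section \<open>Words and substitutions\<close>

definition abelianization :: "'a list \<Rightarrow> real^'a::finite" where
  "abelianization u = (\<chi> i. real (count_list u i))"

definition is_substitution :: "('a \<Rightarrow> 'a list) \<Rightarrow> bool" where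
  "is_substitution \<theta> \<longleftrightarrow> (\<forall>a. \<theta> a \<noteq> [])"

definition subst_word :: "('a \<Rightarrow> 'a list) \<Rightarrow> 'a list \<Rightarrow> 'a list" where
  "subst_word \<theta> u = concat (map \<theta> u)"

definition subst_matrix :: "('a \<Rightarrow> 'a list) \<Rightarrow> int^'a^'a::finite" where
  "subst_matrix \<theta> = (\<chi> i j. int (count_list (\<theta> j) i))"

definition compatible :: "('a::finite \<Rightarrow> 'a list) set \<Rightarrow> bool" where
  "compatible \<Theta> \<longleftrightarrow> \<Theta> \<noteq> {} \<and> (\<forall>\<theta>\<in>\<Theta>. is_substitution \<theta>) \<and>
     (\<forall>\<theta>\<in>\<Theta>. \<forall>\<theta>'\<in>\<Theta>. subst_matrix \<theta> = subst_matrix \<theta>')"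

section \<open>Perron--Frobenius data and the Pisot property\<close>

text \<open>Powers are iterated \<open>**\<close>; the class operation \<open>^\<close> on vectors is componentwise.\<close>

definition primitive_matrix :: "int^'a^'a::finite \<Rightarrow> bool" where
  "primitive_matrix M \<longleftrightarrow> (\<forall>i j. M $ i $ j \<ge> 0) \<and>
     (\<exists>k\<ge>1. \<forall>i j. (((**) M) ^^ k) (mat 1) $ i $ j > 0)"

definition char_polynomial :: "int^'a^'a::finite \<Rightarrow> int poly" where
  "char_polynomial M = det (mat [:0, 1:] - map_matrix (\<lambda>c. [:c:]) M)"

definition is_eigenvalue :: "'k::field^'a^'a::finite \<Rightarrow> 'k \<Rightarrow> bool" where
  "is_eigenvalue A z \<longleftrightarrow> (\<exists>v. v \<noteq> 0 \<and> A *v v = z *s v)"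

text \<open>For a nonnegative matrix the Perron--Frobenius eigenvalue is the real eigenvalue equal to
  the spectral radius.\<close>

definition pf_eigenvalue :: "int^'a^'a::finite \<Rightarrow> real \<Rightarrow> bool" where
  "pf_eigenvalue M l \<longleftrightarrow> is_eigenvalue (map_matrix real_of_int M) l \<and>
     (\<forall>z. is_eigenvalue (map_matrix complex_of_int M) z \<longrightarrow> cmod z \<le> l)"

definition right_pf_eigenvector :: "int^'a^'a::finite \<Rightarrow> real^'a \<Rightarrow> bool" where
  "right_pf_eigenvector M R \<longleftrightarrow>
     R \<noteq> 0 \<and> (\<exists>l. pf_eigenvalue M l \<and> map_matrix real_of_int M *v R = l *\<^sub>R R)"

definition left_pf_eigenvector :: "int^'a^'a::finite \<Rightarrow> real^'a \<Rightarrow> bool" where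
  "left_pf_eigenvector M L \<longleftrightarrow>
     L \<noteq> 0 \<and> (\<exists>l. pf_eigenvalue M l \<and> L v* map_matrix real_of_int M = l *\<^sub>R L)"

text \<open>The monic irreducible \<open>p\<close> below is the minimal polynomial of \<open>x\<close>, and its other roots are
  the Galois conjugates of \<open>x\<close>.\<close>

definition pisot_number :: "real \<Rightarrow> bool" where
  "pisot_number x \<longleftrightarrow> x > 1 \<and>
     (\<exists>p::int poly. lead_coeff p = 1 \<and> irreducible p \<and> poly (map_poly of_int p) x = 0 \<and>
        (\<forall>z::complex. poly (map_poly of_int p) z = 0 \<longrightarrow> z \<noteq> of_real x \<longrightarrow> cmod z < 1))"

definition irreducible_pisot :: "int^'a^'a::finite \<Rightarrow> bool" where
  "irreducible_pisot M \<longleftrightarrow>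
     (\<exists>l. pf_eigenvalue M l \<and> pisot_number l) \<and> irreducible (char_polynomial M)"

text \<open>The projection along \<open>R\<close> onto the hyperplane orthogonal to \<open>L\<close>; see the lemma below.\<close>

definition pf_projection :: "real^'a::finite \<Rightarrow> real^'a \<Rightarrow> real^'a \<Rightarrow> real^'a" where
  "pf_projection L R x = x - ((L \<bullet> x) / (L \<bullet> R)) *\<^sub>R R"

lemma pf_projection_characterization:
  assumes "L \<bullet> R \<noteq> 0"
  shows "linear (pf_projection L R)"
    and "pf_projection L R x = y \<longleftrightarrow> L \<bullet> y = 0 \<and> x - y \<in> span {R}"
proof -
  show "linear (pf_projection L R)"
    by (rule linearI) (auto simp: pf_projection_def inner_add_right algebra_simps add_divide_distrib)
  show "pf_projection L R x = y \<longleftrightarrow> L \<bullet> y = 0 \<and> x - y \<in> span {R}"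
  proof
    assume "pf_projection L R x = y"
    then show "L \<bullet> y = 0 \<and> x - y \<in> span {R}"
      using assms by (auto simp: pf_projection_def inner_diff_right span_singleton)
  next
    assume *: "L \<bullet> y = 0 \<and> x - y \<in> span {R}"
    then obtain t where "x - y = t *\<^sub>R R"
      by (auto simp: span_singleton)
    then have t: "x = y + t *\<^sub>R R"
      by (simp add: algebra_simps)
    show "pf_projection L R x = y"
      using * assms by (simp add: t pf_projection_def inner_add_right)
  qed
qed

section \<open>Subtiles of a sequence\<close>

definition seq_prefix :: "(nat \<Rightarrow> 'a) \<Rightarrow> nat \<Rightarrow> 'a list" where
  "seq_prefix w n = map w [0..<n]"

definition letter_points :: "(nat \<Rightarrow> 'a::finite) \<Rightarrow> 'a \<Rightarrow> (real^'a) set" where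
  "letter_points w a = {abelianization (seq_prefix w n) |n. w n = a}"

definition seq_subtile ::
  "real^'a \<Rightarrow> real^'a \<Rightarrow> (nat \<Rightarrow> 'a::finite) \<Rightarrow> 'a \<Rightarrow> (real^'a) set" where
  "seq_subtile L R w a = closure (pf_projection L R ` letter_points w a)"

section \<open>S-adic subtiles\<close>

definition adapted :: "(nat \<Rightarrow> 'a \<Rightarrow> 'a list) \<Rightarrow> (nat \<Rightarrow> 'a) \<Rightarrow> bool" where
  "adapted \<theta> \<alpha> \<longleftrightarrow> (\<forall>n. hd (\<theta> (Suc n) (\<alpha> (Suc n))) = \<alpha> n)"

definition sadic_word :: "(nat \<Rightarrow> 'a \<Rightarrow> 'a list) \<Rightarrow> nat \<Rightarrow> 'a list \<Rightarrow> 'a list" where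
  "sadic_word \<theta> n u = foldr (\<lambda>i. subst_word (\<theta> i)) [0..<Suc n] u"

definition sadic_seq :: "(nat \<Rightarrow> 'a \<Rightarrow> 'a list) \<Rightarrow> (nat \<Rightarrow> 'a) \<Rightarrow> nat \<Rightarrow> 'a" where
  "sadic_seq \<theta> \<alpha> = (THE u. \<forall>n. seq_prefix u (length (sadic_word \<theta> n [\<alpha> n])) = sadic_word \<theta> n [\<alpha> n])"

text \<open>The value does not depend on the adapted sequence \<open>\<alpha>\<close>.\<close>

definition sadic_subtile ::
  "real^'a \<Rightarrow> real^'a \<Rightarrow> (nat \<Rightarrow> 'a::finite \<Rightarrow> 'a list) \<Rightarrow> 'a \<Rightarrow> (real^'a) set" where
  "sadic_subtile L R \<theta> a = (THE T. \<exists>\<alpha>. adapted \<theta> \<alpha> \<and> T = seq_subtile L R (sadic_seq \<theta> \<alpha>) a)"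

section \<open>Random substitutions\<close>

definition enveloping :: "('a \<Rightarrow> 'a list) set \<Rightarrow> 'a \<Rightarrow> 'a list set" where
  "enveloping \<Theta> a = (\<lambda>\<theta>. \<theta> a) ` \<Theta>"

text \<open>The image of each letter occurrence is chosen independently.\<close>

definition rsubst_word :: "('a \<Rightarrow> 'a list set) \<Rightarrow> 'a list \<Rightarrow> 'a list set" where
  "rsubst_word \<phi> u = concat ` listset (map \<phi> u)"

text \<open>Concatenation of infinitely many words, all of them nonempty.\<close>

definition seq_concat :: "(nat \<Rightarrow> 'a list) \<Rightarrow> nat \<Rightarrow> 'a" where
  "seq_concat v i = concat (map v [0..<Suc i]) ! i"

lemma seq_concat_prefix:
  assumes "\<And>i. v i \<noteq> []"
  shows "seq_prefix (seq_concat v) (length (concat (map v [0..<n]))) = concat (map v [0..<n])"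
proof (rule nth_equalityI)
  have len: "m \<le> length (concat (map v [0..<m]))" for m
  proof (induction m)
    case (Suc m)
    have "length (v m) \<ge> 1" using assms[of m] by (cases "v m") auto
    with Suc show ?case by simp
  qed simp
  have pre: "concat (map v [0..<m]) ! i = concat (map v [0..<k]) ! i"
    if "m \<le> k" "i < length (concat (map v [0..<m]))" for m k i
  proof -
    have "[0..<k] = [0..<m] @ [m..<k]"
      using that(1) by (metis le_add_diff_inverse upt_add_eq_append zero_le)
    then show ?thesis using that(2) by (simp add: nth_append)
  qed
  fix i assume "i < length (seq_prefix (seq_concat v) (length (concat (map v [0..<n]))))"
  then have i: "i < length (concat (map v [0..<n]))" by (simp add: seq_prefix_def)
  have "i < length (concat (map v [0..<Suc i]))" using len[of "Suc i"] by linarith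
  then have "concat (map v [0..<Suc i]) ! i = concat (map v [0..<n]) ! i"
    using i pre[of n "Suc i" i] pre[of "Suc i" n i] by (cases "n \<le> Suc i") auto
  then show "seq_prefix (seq_concat v) (length (concat (map v [0..<n]))) ! i = concat (map v [0..<n]) ! i"
    using i by (simp add: seq_prefix_def seq_concat_def del: upt_Suc)
qed (simp add: seq_prefix_def)

definition rsubst_seq :: "('a \<Rightarrow> 'a list set) \<Rightarrow> (nat \<Rightarrow> 'a) \<Rightarrow> (nat \<Rightarrow> 'a) set" where
  "rsubst_seq \<phi> x = {seq_concat v |v. \<forall>i. v i \<in> \<phi> (x i)}"

definition rsubst_words :: "('a \<Rightarrow> 'a list set) \<Rightarrow> 'a list set \<Rightarrow> 'a list set" where
  "rsubst_words \<phi> U = (\<Union>u\<in>U. rsubst_word \<phi> u)"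

definition rsubst_seqs :: "('a \<Rightarrow> 'a list set) \<Rightarrow> (nat \<Rightarrow> 'a) set \<Rightarrow> (nat \<Rightarrow> 'a) set" where
  "rsubst_seqs \<phi> X = (\<Union>x\<in>X. rsubst_seq \<phi> x)"

definition rsubst_shift :: "('a \<Rightarrow> 'a list set) \<Rightarrow> (nat \<Rightarrow> 'a) set" where
  "rsubst_shift \<phi> =
     {x. \<forall>i j. \<exists>b k. \<exists>v\<in>(rsubst_words \<phi> ^^ k) {[b]}. sublist (map x [i..<j]) v}"

definition rsubst_shift_infinity :: "('a \<Rightarrow> 'a list set) \<Rightarrow> (nat \<Rightarrow> 'a) set" where
  "rsubst_shift_infinity \<phi> = (\<Inter>n. (rsubst_seqs \<phi> ^^ n) (rsubst_shift \<phi>))"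

definition shift :: "(nat \<Rightarrow> 'a) \<Rightarrow> nat \<Rightarrow> 'a" where
  "shift x = (\<lambda>i. x (Suc i))"

definition dense_orbit_in :: "(nat \<Rightarrow> 'a) \<Rightarrow> (nat \<Rightarrow> 'a) set \<Rightarrow> bool" where
  "dense_orbit_in w X \<longleftrightarrow>
     X \<subseteq> product_topology (\<lambda>_. discrete_topology UNIV) UNIV closure_of {(shift ^^ n) w |n. True}"

text \<open>The value does not depend on the choice of \<open>w\<close>.\<close>

definition rsubst_subtile ::
  "real^'a \<Rightarrow> real^'a \<Rightarrow> ('a::finite \<Rightarrow> 'a list set) \<Rightarrow> 'a \<Rightarrow> (real^'a) set" where
  "rsubst_subtile L R \<phi> a =
     (THE T. \<exists>w\<in>rsubst_shift_infinity \<phi>. dense_orbit_in w (rsubst_shift \<phi>) \<and> T = seq_subtile L R w a)"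

end

theory Submission
  imports Defs "HOL-Computational_Algebra.Polynomial_Factorial"
    "HOL-Computational_Algebra.Fundamental_Theorem_Algebra"
begin

text \<open>The idea is that a point of a subtile remembers only one substitution per level. If
  \<open>w\<close> is obtained from \<open>x\<close> by substituting each letter separately, and position \<open>m\<close> of \<open>w\<close>
  lies in the block \<open>\<theta> (x j) = p @ w m # r\<close>, then all blocks in front of it contribute
  \<open>A *v abelianization (x\<^sub>0 \<dots> x\<^sub>j\<^sub>-\<^sub>1)\<close>, whichever substitutions were used for them, because all of
  them have the same matrix \<open>A\<close>. Iterating, the abelianized prefix at a position with letter \<open>a\<close> is
  \<open>\<Sum>i<n. A^i (abelianization p\<^sub>i)\<close> plus \<open>A^n\<close> of an abelianized prefix, where \<open>b\<^sub>0 = a\<close> and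
  \<open>p\<^sub>i @ [b\<^sub>i]\<close> is a prefix of \<open>\<theta>\<^sub>i (b\<^sub>i\<^sub>+\<^sub>1)\<close>. After projection along the expanding direction \<open>A\<close> is a
  contraction, so the last term vanishes in the limit.

  Hence every subtile is a set of infinite digit expansions \<open>\<Sum>i. A^i (\<pi> (abelianization p\<^sub>i))\<close>
  (\<open>digit_tile\<close>): for an S-adic subtile the digits at level \<open>i\<close> are read from \<open>\<theta>\<^sub>i\<close>
  (\<open>sadic_subtile_eq_digit_tile\<close>), and for the random substitution from an arbitrary element of
  \<open>\<Theta>\<close> at each level (\<open>rsubst_subtile_eq_digit_tile\<close>). The second kind of expansion is one of the
  first kind for a suitable sequence in \<open>\<Theta>\<close>, so the union formula is immediate. The two
  descriptions also show that the subtiles do not depend on the adapted sequence and on the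
  sequence with dense orbit.

  That subtiles consist of digit expansions (\<open>seq_subtile_subset\<close>) follows by desubstitution and a
  compactness argument on the finitely many digits (\<open>digit_tileI\<close>). Conversely, in the S-adic case
  any initial segment of an expansion can be realized by a position of the sequence, because by
  primitivity each letter occurs early in every desubstituted sequence. In the random case there
  is no reason that a dense sequence is desubstituted in a prescribed way at a prescribed place;
  all that density gives is a legal word, occurring somewhere, in which all inflated words of
  level \<open>n\<close> appear at their inflation positions (\<open>universal_word\<close>). This shows only that some translate of
  the set \<open>E\<close> of expansions is contained in the subtile (\<open>translated_digit_tile_subset\<close>). But the
  subtile is contained in \<open>E\<close>, so \<open>t + E \<subseteq> E\<close> with \<open>E\<close> bounded, which forces \<open>t = 0\<close>.

  The contraction comes from the Pisot hypothesis (\<open>contraction_on_hyperplane\<close>): an irreducible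
  characteristic polynomial is separable, so the matrix is diagonalizable over the complex numbers,
  the complexified hyperplane orthogonal to \<open>L\<close> is spanned by the eigenvectors of the eigenvalues other than
  the Perron--Frobenius eigenvalue, and these eigenvalues are its Galois conjugates.\<close>

section \<open>Abelianizations and prefixes\<close>

lemma abelianization_Nil [simp]: "abelianization [] = 0"
  by (simp add: abelianization_def vec_eq_iff)

lemma abelianization_append: "abelianization (u @ v) = abelianization u + abelianization v"
  by (simp add: abelianization_def vec_eq_iff)

lemma abelianization_Cons: "abelianization (c # v) = abelianization [c] + abelianization v"
  using abelianization_append[of "[c]" v] by simp

lemma norm_abelianization_le: "norm (abelianization u) \<le> length u"
proof (induction u)
  case (Cons c u)
  have "abelianization [c] = axis c 1" by (auto simp: abelianization_def axis_def vec_eq_iff)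
  then have "norm (abelianization [c]) = 1" by (simp add: norm_axis_1)
  then show ?case
    using Cons norm_triangle_ineq[of "abelianization [c]" "abelianization u"]
    by (subst abelianization_Cons) simp
qed simp

lemma length_seq_prefix [simp]: "length (seq_prefix w n) = n"
  by (simp add: seq_prefix_def)

lemma nth_seq_prefix [simp]: "i < n \<Longrightarrow> seq_prefix w n ! i = w i"
  by (simp add: seq_prefix_def)

lemma seq_prefix_0 [simp]: "seq_prefix w 0 = []"
  by (simp add: seq_prefix_def)

lemma seq_prefix_Suc: "seq_prefix w (Suc n) = seq_prefix w n @ [w n]"
  by (simp add: seq_prefix_def)

lemma seq_prefix_add: "seq_prefix w (m + n) = seq_prefix w m @ map w [m..<m + n]"
  by (simp add: seq_prefix_def upt_add_eq_append[of 0 m, simplified])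

lemma prefix_seq_prefix: "m \<le> n \<Longrightarrow> prefix (seq_prefix w m) (seq_prefix w n)"
  using seq_prefix_add[of w m "n - m"] by (simp add: prefix_def)

lemma seq_prefix_eq_iff_take: "n \<le> length v \<Longrightarrow> seq_prefix w n = take n v \<longleftrightarrow> (\<forall>i<n. w i = v ! i)"
  by (auto simp: list_eq_iff_nth_eq)

lemma seq_prefix_prefix_eq:
  assumes "seq_prefix w (length v) = v" "prefix (q @ [c]) v"
  shows "seq_prefix w (length q) = q" "w (length q) = c"
proof -
  obtain r where v: "v = q @ [c] @ r" using assms(2) by (auto simp: prefix_def)
  have "seq_prefix w (length q) = take (length q) v"
    using assms(1) v by (subst seq_prefix_eq_iff_take) (auto simp: list_eq_iff_nth_eq)
  then show "seq_prefix w (length q) = q" using v by simp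
  have "v ! length q = c" "length q < length v" using v by simp_all
  then show "w (length q) = c" using assms(1) nth_seq_prefix[of "length q" "length v" w] by simp
qed

text \<open>Produces all the infinite words of this development: compactness limits, S-adic sequences, and
  a sequence with dense orbit.\<close>
lemma nested_words_limit:
  fixes W :: "nat \<Rightarrow> 'c list"
  assumes nested: "\<And>n. prefix (W n) (W (Suc n))" and unbounded: "\<And>N. \<exists>n. N \<le> length (W n)"
  shows "\<exists>!w. \<forall>n. seq_prefix w (length (W n)) = W n"
proof
  have mono: "prefix (W m) (W n)" if "m \<le> n" for m n
    using that by (induction n rule: dec_induct) (auto intro: prefix_order.trans nested)
  define idx where "idx i = (SOME n. Suc i \<le> length (W n))" for i
  have idx: "i < length (W (idx i))" for i
    unfolding idx_def using someI_ex[OF unbounded[of "Suc i"]] by simp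
  define w where "w i = W (idx i) ! i" for i
  have "w i = W n ! i" if "i < length (W n)" for i n
    using that idx[of i] mono[of n "idx i"] mono[of "idx i" n]
    unfolding w_def by (cases "n \<le> idx i") (auto simp: prefix_def nth_append)
  then show "\<forall>n. seq_prefix w (length (W n)) = W n"
    by (auto intro!: nth_equalityI)
  fix w' assume "\<forall>n. seq_prefix w' (length (W n)) = W n"
  then have "w' i = w i" for i
    unfolding w_def using idx[of i] nth_seq_prefix[OF idx[of i], of w'] by simp
  then show "w' = w" by blast
qed

text \<open>The sequential compactness of the space of sequences over \<open>F\<close>. Finite data of growing length are
  covered as well, padded with an arbitrary element of \<open>F\<close>.\<close>
lemma finite_alphabet_limit:
  fixes f :: "nat \<Rightarrow> nat \<Rightarrow> 'c"
  assumes "finite F" and "\<And>n i. f n i \<in> F"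
  shows "\<exists>g. \<forall>N. \<exists>n\<ge>N. \<forall>i<N. f n i = g i"
proof -
  \<comment> \<open>\<open>xs N\<close> is a word of length \<open>N\<close> that infinitely many \<open>f n\<close> have as a prefix.\<close>
  have "\<exists>xs. \<forall>N. (length (xs N) = N \<and> infinite {n. seq_prefix (f n) N = xs N}) \<and> prefix (xs N) (xs (Suc N))"
  proof (rule dependent_nat_choice)
    show "\<exists>x. length x = 0 \<and> infinite {n. seq_prefix (f n) 0 = x}" by simp
    fix x :: "'c list" and N assume x: "length x = N \<and> infinite {n. seq_prefix (f n) N = x}"
    let ?A = "{n. seq_prefix (f n) N = x}"
    have fin: "finite ((\<lambda>n. f n N) ` ?A)" by (rule finite_subset[OF _ assms(1)]) (use assms(2) in blast)
    have "\<exists>m\<in>?A. infinite {n \<in> ?A. f n N = f m N}"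
      by (rule pigeonhole_infinite[OF conjunct2[OF x] fin])
    then obtain m where "m \<in> ?A" "infinite {n \<in> ?A. f n N = f m N}" by (rule bexE)
    moreover have "{n. seq_prefix (f n) (Suc N) = x @ [f m N]} = {n \<in> ?A. f n N = f m N}"
      by (auto simp: seq_prefix_Suc)
    ultimately show "\<exists>y. (length y = Suc N \<and> infinite {n. seq_prefix (f n) (Suc N) = y}) \<and> prefix x y"
      using x by (intro exI[of _ "x @ [f m N]"]) auto
  qed
  then obtain xs where xs: "\<And>N. length (xs N) = N" "\<And>N. infinite {n. seq_prefix (f n) N = xs N}"
    "\<And>N. prefix (xs N) (xs (Suc N))" by metis
  have "\<exists>!g. \<forall>N. seq_prefix g (length (xs N)) = xs N"
  proof (rule nested_words_limit)
    show "prefix (xs n) (xs (Suc n))" for n by (rule xs(3))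
    show "\<exists>n. N \<le> length (xs n)" for N by (rule exI[of _ N]) (simp add: xs(1))
  qed
  then obtain g where g: "\<And>N. seq_prefix g (length (xs N)) = xs N" by blast
  have "\<exists>n\<ge>N. \<forall>i<N. f n i = g i" for N
  proof -
    obtain n where n: "n \<ge> N" "seq_prefix (f n) N = xs N"
      using xs(2)[of N] unfolding infinite_nat_iff_unbounded_le by blast
    then have "seq_prefix (f n) N = seq_prefix g N" using g[of N] xs(1) by simp
    then have "f n i = g i" if "i < N" for i using that by (metis nth_seq_prefix)
    then show ?thesis using n(1) by blast
  qed
  then show ?thesis by blast
qed

text \<open>Every position of an infinite concatenation lies in a block. The index of the block is at most
  the position because blocks are nonempty; this keeps the remainder term bounded when
  desubstitution is iterated.\<close>
lemma seq_concat_position: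
  assumes ne: "\<And>i. v i \<noteq> []"
  obtains j p r where "j \<le> m" "v j = p @ seq_concat v m # r"
    "seq_prefix (seq_concat v) m = concat (map v [0..<j]) @ p"
proof -
  let ?c = "\<lambda>n. concat (map v [0..<n])"
  have len: "n \<le> length (?c n)" for n
  proof (induction n)
    case (Suc n)
    have "length (v n) \<ge> 1" using ne[of n] by (cases "v n") auto
    with Suc show ?case by simp
  qed simp
  define j where "j = (GREATEST j. length (?c j) \<le> m)"
  have bdd: "length (?c j) \<le> m \<Longrightarrow> j \<le> m" for j using len[of j] by linarith
  have j: "length (?c j) \<le> m"
    unfolding j_def by (rule GreatestI_nat[where b = m and k = 0]) (simp, rule bdd)
  have "\<not> length (?c (Suc j)) \<le> m"
  proof
    assume "length (?c (Suc j)) \<le> m"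
    then have "Suc j \<le> j" unfolding j_def by (rule Greatest_le_nat[where b = m]) (rule bdd)
    then show False by simp
  qed
  then have j': "m < length (?c (Suc j))" by simp
  define k where "k = m - length (?c j)"
  have k: "k < length (v j)" "m = length (?c j) + k" using j j' by (auto simp: k_def)
  have cs: "?c (Suc j) = (?c j @ take k (v j)) @ [v j ! k] @ drop (Suc k) (v j)"
    using k by (simp add: id_take_nth_drop[symmetric])
  have pre: "seq_prefix (seq_concat v) (length (?c (Suc j))) = ?c (Suc j)"
    by (rule seq_concat_prefix[OF ne])
  have "prefix ((?c j @ take k (v j)) @ [v j ! k]) (?c (Suc j))"
    unfolding cs by (simp only: prefix_def append_assoc) blast
  note eqs = seq_prefix_prefix_eq[OF pre this]
  have lenm: "length (?c j @ take k (v j)) = m" using k by simp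
  show thesis
  proof (rule that)
    show "j \<le> m" using bdd[OF j] .
    show "v j = take k (v j) @ seq_concat v m # drop (Suc k) (v j)"
      using eqs(2) lenm k(1) by (metis id_take_nth_drop)
    show "seq_prefix (seq_concat v) m = ?c j @ take k (v j)" using eqs(1) lenm by simp
  qed
qed

lemma seq_concat_at:
  assumes ne: "\<And>i. v i \<noteq> []" and "prefix (p @ [c]) (v j)"
  defines "q \<equiv> concat (map v [0..<j]) @ p"
  shows "seq_prefix (seq_concat v) (length q) = q" "seq_concat v (length q) = c"
proof -
  have "prefix (q @ [c]) (concat (map v [0..<Suc j]))"
    using assms(2) by (auto simp: q_def prefix_def)
  note seq_prefix_prefix_eq[OF seq_concat_prefix[OF ne] this]
  then show "seq_prefix (seq_concat v) (length q) = q" "seq_concat v (length q) = c" by auto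
qed

section \<open>Random substitutions of words\<close>

lemma rsubst_word_Nil [simp]: "rsubst_word \<phi> [] = {[]}"
  by (simp add: rsubst_word_def)

lemma rsubst_word_Cons: "rsubst_word \<phi> (c # u) = {x @ y |x y. x \<in> \<phi> c \<and> y \<in> rsubst_word \<phi> u}"
proof -
  have "rsubst_word \<phi> (c # u) = concat ` {x # xs |x xs. x \<in> \<phi> c \<and> xs \<in> listset (map \<phi> u)}"
    by (simp add: rsubst_word_def set_Cons_def)
  also have "\<dots> = {x @ y |x y. x \<in> \<phi> c \<and> y \<in> concat ` listset (map \<phi> u)}"
    by (auto simp: image_iff) (metis concat.simps(2))+
  finally show ?thesis by (simp add: rsubst_word_def)
qed

lemma rsubst_word_append:
  "rsubst_word \<phi> (u @ v) = {x @ y |x y. x \<in> rsubst_word \<phi> u \<and> y \<in> rsubst_word \<phi> v}"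
proof (induction u)
  case (Cons c u)
  show ?case
    unfolding append_Cons rsubst_word_Cons Cons.IH
  proof (intro set_eqI iffI; clarify)
    fix x y z assume "x \<in> \<phi> c" "y \<in> rsubst_word \<phi> u" "z \<in> rsubst_word \<phi> v"
    then show "\<exists>x' y'. x @ y @ z = x' @ y' \<and>
        x' \<in> {x @ y |x y. x \<in> \<phi> c \<and> y \<in> rsubst_word \<phi> u} \<and> y' \<in> rsubst_word \<phi> v"
      by (intro exI[of _ "x @ y"] exI[of _ z]) auto
  next
    fix x y z assume "x \<in> \<phi> c" "y \<in> rsubst_word \<phi> u" "z \<in> rsubst_word \<phi> v"
    then show "\<exists>x' y'. (x @ y) @ z = x' @ y' \<and> x' \<in> \<phi> c \<and>
        y' \<in> {x @ y |x y. x \<in> rsubst_word \<phi> u \<and> y \<in> rsubst_word \<phi> v}"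
      by (intro exI[of _ x] exI[of _ "y @ z"]) auto
  qed
qed simp

text \<open>The list \<open>g\<close> remembers the inflation boundaries that concatenation forgets.\<close>
lemma rsubst_word_blocks:
  "x \<in> rsubst_word \<phi> u \<longleftrightarrow> (\<exists>g. list_all2 (\<lambda>v c. v \<in> \<phi> c) g u \<and> x = concat g)"
proof (induction u arbitrary: x)
  case (Cons c u)
  show ?case
    unfolding rsubst_word_Cons mem_Collect_eq Cons.IH list_all2_Cons2 by force
qed simp

section \<open>Powers of the random substitution and legal words\<close>

lemma mem_enveloping: "v \<in> enveloping \<Theta> c \<longleftrightarrow> (\<exists>\<theta>\<in>\<Theta>. v = \<theta> c)"
  by (auto simp: enveloping_def)

text \<open>Compatibility enters through one matrix \<open>A\<close> that acts on abelianizations as every member of the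
  family does on words.\<close>
locale substitution_family =
  fixes \<Theta> :: "('a::finite \<Rightarrow> 'a list) set" and A :: "real^'a^'a"
  assumes family_nonempty: "\<Theta> \<noteq> {}" and family_finite: "finite \<Theta>"
    and image_nonempty: "\<theta> \<in> \<Theta> \<Longrightarrow> \<theta> c \<noteq> []"
    and abelianization_image: "\<theta> \<in> \<Theta> \<Longrightarrow> abelianization (\<theta> c) = A *v abelianization [c]"
begin

text \<open>The realizations of the \<open>k\<close>-th power of the enveloping random substitution on \<open>u\<close>.\<close>
definition level :: "nat \<Rightarrow> 'a list \<Rightarrow> 'a list set" where
  "level k u = (rsubst_words (enveloping \<Theta>) ^^ k) {u}"

lemma rsubst_words_funpow: "(rsubst_words (enveloping \<Theta>) ^^ k) U = (\<Union>u\<in>U. level k u)"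
proof (induction k)
  case (Suc k)
  then show ?case unfolding level_def by (auto simp: rsubst_words_def)
qed (simp add: level_def)

lemma level_0 [simp]: "level 0 u = {u}"
  by (simp add: level_def)

lemma level_Suc: "level (Suc k) u = (\<Union>v\<in>level k u. rsubst_word (enveloping \<Theta>) v)"
  by (simp add: level_def rsubst_words_def)

lemma level_1: "level (Suc 0) u = rsubst_word (enveloping \<Theta>) u"
  by (simp add: level_Suc)

lemma level_add: "level (j + k) u = (\<Union>v\<in>level k u. level j v)"
  by (subst level_def) (simp add: funpow_add rsubst_words_funpow)

lemma level_transitive: "v \<in> level k u \<Longrightarrow> x \<in> level j v \<Longrightarrow> x \<in> level (j + k) u"
  by (auto simp: level_add)

lemma level_append: "level k (u @ v) = {x @ y |x y. x \<in> level k u \<and> y \<in> level k v}"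
proof (induction k)
  case (Suc k)
  show ?case
    unfolding level_Suc Suc.IH
  proof (intro set_eqI iffI; clarsimp simp: rsubst_word_append)
    fix x y p q assume "x \<in> level k u" "y \<in> level k v"
      "p \<in> rsubst_word (enveloping \<Theta>) x" "q \<in> rsubst_word (enveloping \<Theta>) y"
    then show "\<exists>p' q'. p @ q = p' @ q' \<and> (\<exists>x\<in>level k u. p' \<in> rsubst_word (enveloping \<Theta>) x) \<and>
        (\<exists>y\<in>level k v. q' \<in> rsubst_word (enveloping \<Theta>) y)" by blast
  next
    fix x y p q assume "x \<in> level k u" "y \<in> level k v"
      "p \<in> rsubst_word (enveloping \<Theta>) x" "q \<in> rsubst_word (enveloping \<Theta>) y"
    then show "\<exists>z. (\<exists>x y. z = x @ y \<and> x \<in> level k u \<and> y \<in> level k v) \<and>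
        p @ q \<in> rsubst_word (enveloping \<Theta>) z"
      by (intro exI[of _ "x @ y"]) (auto simp: rsubst_word_append)
  qed
qed simp

lemma level_appendI: "x \<in> level k u \<Longrightarrow> y \<in> level k v \<Longrightarrow> x @ y \<in> level k (u @ v)"
  by (auto simp: level_append)

lemma level_Cons: "level k (c # v) = {x @ y |x y. x \<in> level k [c] \<and> y \<in> level k v}"
  using level_append[of k "[c]" v] by simp

lemma subst_word_in_rsubst_word: "\<theta> \<in> \<Theta> \<Longrightarrow> subst_word \<theta> u \<in> rsubst_word (enveloping \<Theta>) u"
  by (induction u) (auto simp: subst_word_def rsubst_word_Cons mem_enveloping)

lemma level_ex: "\<exists>v. v \<in> level k u"
proof (induction k)
  case (Suc k)
  obtain \<theta> where "\<theta> \<in> \<Theta>" using family_nonempty by auto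
  with Suc show ?case using subst_word_in_rsubst_word by (force simp: level_Suc)
qed simp

lemma level_Nil [simp]: "level k [] = {[]}"
  by (induction k) (auto simp: level_Suc)

text \<open>Independent choices of the images do not affect the abelianization: this is where all
  members having one matrix enters.\<close>
lemma rsubst_word_abelianization_length:
  "v \<in> rsubst_word (enveloping \<Theta>) u \<Longrightarrow>
    abelianization v = A *v abelianization u \<and> length u \<le> length v"
proof (induction u arbitrary: v)
  case (Cons c u)
  obtain \<theta> y where v: "v = \<theta> c @ y" "\<theta> \<in> \<Theta>" "y \<in> rsubst_word (enveloping \<Theta>) u"
    using Cons.prems by (auto simp: rsubst_word_Cons mem_enveloping)
  have "1 \<le> length (\<theta> c)" using image_nonempty[OF v(2), of c] by (cases "\<theta> c") auto
  moreover have "abelianization v = A *v abelianization (c # u)"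
    using v Cons.IH[OF v(3)] abelianization_Cons[of c u]
    by (simp add: abelianization_append abelianization_image matrix_vector_right_distrib)
  ultimately show ?case using v(1) Cons.IH[OF v(3)] by simp
qed simp

lemma abelianization_level: "v \<in> level k u \<Longrightarrow> abelianization v = ((*v) A ^^ k) (abelianization u)"
  by (induction k arbitrary: v) (auto simp: level_Suc rsubst_word_abelianization_length)

lemma level_length: "v \<in> level k u \<Longrightarrow> length u \<le> length v"
  by (induction k arbitrary: v) (auto simp: level_Suc dest!: rsubst_word_abelianization_length intro: order_trans)

definition maxlen :: nat where
  "maxlen = Max ((\<lambda>(\<theta>, c). length (\<theta> c)) ` (\<Theta> \<times> UNIV))"

lemma image_length_le: "\<theta> \<in> \<Theta> \<Longrightarrow> length (\<theta> c) \<le> maxlen"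
  unfolding maxlen_def using family_finite by (intro Max_ge) (auto intro: rev_image_eqI[of "(\<theta>, c)"])

lemma maxlen_pos: "1 \<le> maxlen"
proof -
  obtain \<theta> where t: "\<theta> \<in> \<Theta>" using family_nonempty by auto
  have "1 \<le> length (\<theta> undefined)" using image_nonempty[OF t, of undefined] by (cases "\<theta> undefined") auto
  then show ?thesis using image_length_le[OF t, of undefined] by linarith
qed

lemma finite_rsubst_word: "finite (rsubst_word (enveloping \<Theta>) u)"
proof (induction u)
  case (Cons c u)
  have "rsubst_word (enveloping \<Theta>) (c # u) =
      (\<lambda>(x, y). x @ y) ` (enveloping \<Theta> c \<times> rsubst_word (enveloping \<Theta>) u)"
    by (auto simp: rsubst_word_Cons)
  moreover have "finite (enveloping \<Theta> c)" using family_finite by (simp add: enveloping_def)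
  ultimately show ?case using Cons by simp
qed simp

lemma finite_level: "finite (level k u)"
  by (induction k) (auto simp: level_Suc finite_rsubst_word)

lemma foldr_subst_word_level:
  "(\<And>i. i \<in> set is \<Longrightarrow> \<theta> i \<in> \<Theta>) \<Longrightarrow> foldr (\<lambda>i. subst_word (\<theta> i)) is u \<in> level (length is) u"
  by (induction "is") (auto simp: level_Suc intro!: subst_word_in_rsubst_word)

text \<open>Cuts a prefix of an inflated word at an inflation boundary such that the rest is a prefix of a
  single inflated letter.\<close>
lemma level_prefix_split:
  assumes "x \<in> level k u" "prefix q x"
  shows "\<exists>u\<^sub>1 u\<^sub>2 x\<^sub>1 q'. u = u\<^sub>1 @ u\<^sub>2 \<and> x\<^sub>1 \<in> level k u\<^sub>1 \<and> q = x\<^sub>1 @ q' \<and>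
    (q' = [] \<or> (\<exists>c v. v \<in> level k [c] \<and> prefix q' v))"
  using assms
proof (induction u arbitrary: x q)
  case (Cons c u)
  obtain y z where x: "x = y @ z" "y \<in> level k [c]" "z \<in> level k u"
    using Cons.prems(1) by (auto simp: level_Cons[of k c u])
  consider "prefix q y" | q' where "q = y @ q'" "prefix q' z"
    using Cons.prems(2) x(1) by (auto simp: prefix_append)
  then show ?case
  proof cases
    case 1
    then show ?thesis
      using x(2) by (intro exI[of _ "[]"] exI[of _ "c # u"] exI[of _ q]) auto
  next
    case 2
    obtain u\<^sub>1 u\<^sub>2 x\<^sub>1 q'' where *: "u = u\<^sub>1 @ u\<^sub>2" "x\<^sub>1 \<in> level k u\<^sub>1" "q' = x\<^sub>1 @ q''"
      "q'' = [] \<or> (\<exists>c v. v \<in> level k [c] \<and> prefix q'' v)"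
      using Cons.IH[OF x(3) 2(2)] by blast
    have "y @ x\<^sub>1 \<in> level k (c # u\<^sub>1)" using x(2) *(2) level_appendI[of y k "[c]" x\<^sub>1 u\<^sub>1] by simp
    then show ?thesis
      using * 2(1) by (intro exI[of _ "c # u\<^sub>1"] exI[of _ u\<^sub>2] exI[of _ "y @ x\<^sub>1"] exI[of _ q'']) auto
  qed
qed simp

definition legal :: "'a list \<Rightarrow> bool" where
  "legal v \<longleftrightarrow> (\<exists>b k. \<exists>v'\<in>level k [b]. sublist v v')"

lemma rsubst_shift_iff: "x \<in> rsubst_shift (enveloping \<Theta>) \<longleftrightarrow> (\<forall>i j. legal (map x [i..<j]))"
  by (simp add: rsubst_shift_def legal_def level_def)

lemma legal_sublist: "legal v \<Longrightarrow> sublist u v \<Longrightarrow> legal u"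
  unfolding legal_def by (meson sublist_order.order.trans)

lemma legal_prefix: "legal v \<Longrightarrow> prefix u v \<Longrightarrow> legal u"
  by (rule legal_sublist) (auto intro: prefix_imp_sublist)

lemma level_sublist:
  assumes "v \<in> level k u" "sublist u u'"
  shows "\<exists>v'\<in>level k u'. sublist v v'"
proof -
  obtain s t where u': "u' = s @ u @ t" using assms(2) by (auto simp: sublist_def)
  obtain s' t' where "s' \<in> level k s" "t' \<in> level k t" using level_ex by blast
  then show ?thesis using assms(1) u'
    by (intro bexI[of _ "s' @ v @ t'"]) (auto intro!: level_appendI)
qed

text \<open>Legality survives inflation since an inflation of a factor extends to an inflation of the
  whole word.\<close>
lemma legal_level: "legal y \<Longrightarrow> v \<in> level n y \<Longrightarrow> legal v"
  unfolding legal_def by (metis level_sublist level_transitive)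

end

section \<open>Occurrences of words and dense orbits\<close>

definition occurs :: "'c list \<Rightarrow> (nat \<Rightarrow> 'c) \<Rightarrow> bool" where
  "occurs v w \<longleftrightarrow> (\<exists>m. map w [m..<m + length v] = v)"

lemma occurs_sublist:
  assumes "sublist v (seq_prefix w n)"
  shows "occurs v w"
proof -
  obtain s t where st: "seq_prefix w n = s @ v @ t" using assms by (auto simp: sublist_def)
  then have n: "n = length s + length v + length t" by (metis length_append length_seq_prefix add.assoc)
  have "map w [length s..<length s + length v] = v"
  proof (rule nth_equalityI)
    fix i assume "i < length (map w [length s..<length s + length v])"
    then have i: "i < length v" by simp
    have "w (length s + i) = seq_prefix w n ! (length s + i)" using i n by simp
    also have "\<dots> = v ! i" unfolding st using i by (simp add: nth_append)
    finally show "map w [length s..<length s + length v] ! i = v ! i" using i by simp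
  qed simp
  then show ?thesis by (auto simp: occurs_def)
qed

lemma shift_funpow: "(shift ^^ n) w i = w (n + i)"
  by (induction n arbitrary: i) (auto simp: shift_def)

lemma openin_cylinder:
  "openin (product_topology (\<lambda>_. discrete_topology UNIV) UNIV) {f. \<forall>i<N. f i = x i}" for x :: "nat \<Rightarrow> 'c"
proof -
  define U where "U i = (if i < N then {x i} else UNIV)" for i
  have "finite {i. U i \<noteq> UNIV}"
    by (rule finite_subset[of _ "{..<N}"]) (auto simp: U_def)
  then have "openin (product_topology (\<lambda>_. discrete_topology UNIV) UNIV) (Pi\<^sub>E UNIV U)"
    by (intro product_topology_basis) simp_all
  moreover have "{f. \<forall>i<N. f i = x i} = Pi\<^sub>E UNIV U"
    unfolding PiE_UNIV_domain by (rule set_eqI) (auto simp: U_def Pi_def)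
  ultimately show ?thesis by simp
qed

text \<open>A basis of the product topology is given by the cylinders, so density of the orbit is a
  statement about finite words.\<close>
lemma dense_orbit_iff:
  "dense_orbit_in w X \<longleftrightarrow> (\<forall>x\<in>X. \<forall>N. \<exists>n. \<forall>i<N. w (n + i) = x i)"
proof -
  let ?T = "product_topology (\<lambda>_::nat. discrete_topology (UNIV :: 'a set)) UNIV"
  have "x \<in> ?T closure_of {(shift ^^ n) w |n. True} \<longleftrightarrow> (\<forall>N. \<exists>n. \<forall>i<N. w (n + i) = x i)" for x
  proof
    assume x: "x \<in> ?T closure_of {(shift ^^ n) w |n. True}"
    show "\<forall>N. \<exists>n. \<forall>i<N. w (n + i) = x i"
    proof
      fix N
      have "x \<in> {f. \<forall>i<N. f i = x i} \<and> openin ?T {f. \<forall>i<N. f i = x i}"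
        using openin_cylinder by simp
      from mp[OF spec[OF conjunct2[OF x[unfolded in_closure_of]]] this]
      obtain n where "(shift ^^ n) w \<in> {f. \<forall>i<N. f i = x i}" by fast
      then have "\<forall>i<N. w (n + i) = x i" by (simp only: mem_Collect_eq shift_funpow)
      then show "\<exists>n. \<forall>i<N. w (n + i) = x i" by (rule exI)
    qed
  next
    assume x: "\<forall>N. \<exists>n. \<forall>i<N. w (n + i) = x i"
    show "x \<in> ?T closure_of {(shift ^^ n) w |n. True}"
      unfolding in_closure_of
    proof (intro conjI allI impI)
      fix T assume "x \<in> T \<and> openin ?T T"
      then obtain U where U: "finite {i. U i \<noteq> UNIV}" "x \<in> Pi\<^sub>E UNIV U" "Pi\<^sub>E UNIV U \<subseteq> T"
        unfolding openin_product_topology_alt by auto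
      obtain N where N: "\<And>i. U i \<noteq> UNIV \<Longrightarrow> i < N"
        using U(1) unfolding finite_nat_set_iff_bounded by blast
      obtain n where n: "\<forall>i<N. w (n + i) = x i" using x by blast
      have "(shift ^^ n) w i \<in> U i" for i
        using U(2) n N[of i] by (cases "i < N") (auto simp: shift_funpow PiE_def Pi_def)
      then have "(shift ^^ n) w \<in> T" using U(3) by (auto simp: PiE_def)
      then show "\<exists>y. y \<in> {(shift ^^ n) w |n. True} \<and> y \<in> T" by blast
    qed simp
  qed
  then show ?thesis unfolding dense_orbit_in_def by blast
qed

text \<open>The two consequences of primitivity and of \<open>\<lambda> > 1\<close> that are used; the length condition
  is not automatic when the alphabet has one letter.\<close>
locale mixing_family = substitution_family +
  fixes \<kappa> :: nat
  assumes mixing: "v \<in> level \<kappa> [b] \<Longrightarrow> c \<in> set v \<and> 2 \<le> length v"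
begin

lemma mixing_exponent_pos: "0 < \<kappa>"
  using mixing[of "[b]" b b for b] by (cases "\<kappa> = 0") auto

lemma level_mixing:
  assumes "\<kappa> \<le> j" "v \<in> level j [b]"
  shows "c \<in> set v" "2 \<le> length v"
proof -
  have "v \<in> level (\<kappa> + (j - \<kappa>)) [b]" using assms by simp
  then obtain v' where v': "v' \<in> level (j - \<kappa>) [b]" "v \<in> level \<kappa> v'" by (auto simp: level_add)
  have "v' \<noteq> []" using level_length[OF v'(1)] by auto
  then obtain d u where "v' = d # u" by (cases v') auto
  then obtain x y where "v = x @ y" "x \<in> level \<kappa> [d]" using v'(2) by (auto simp: level_Cons[of \<kappa> d u])
  then show "c \<in> set v" "2 \<le> length v" using mixing[of x d c] by auto
qed

text \<open>The first letter of \<open>\<theta> c\<close> is a self-map of a finite alphabet, hence has a periodic point \<open>c\<close>.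
  Then some word of a level of \<open>c\<close> starts with \<open>c\<close> again, and nested extension of \<open>c\<close> is possible.\<close>
lemma returning_letter: "\<exists>c k d r. 0 < k \<and> c # d # r \<in> level k [c]"
proof -
  obtain \<theta> where \<theta>: "\<theta> \<in> \<Theta>" using family_nonempty by auto
  define h where "h c = hd (\<theta> c)" for c
  have word: "\<exists>v \<in> level n [c]. hd v = (h ^^ n) c" for n c
  proof (induction n)
    case (Suc n)
    then obtain v where v: "v \<in> level n [c]" "hd v = (h ^^ n) c" by blast
    have "v \<noteq> []" using level_length[OF v(1)] by auto
    then have "hd (subst_word \<theta> v) = h (hd v)"
      using image_nonempty[OF \<theta>] by (cases v) (auto simp: subst_word_def h_def)
    moreover have "subst_word \<theta> v \<in> level (Suc n) [c]"
      using v(1) subst_word_in_rsubst_word[OF \<theta>, of v] by (auto simp: level_Suc)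
    ultimately show ?case using v(2) by (intro bexI[of _ "subst_word \<theta> v"]) auto
  qed simp
  have "\<not> inj (\<lambda>n. (h ^^ n) undefined)"
    using finite_imageD[of "\<lambda>n. (h ^^ n) undefined" UNIV] by (auto intro: finite_subset[OF subset_UNIV])
  then obtain i j where ij: "i < j" "(h ^^ i) undefined = (h ^^ j) undefined"
    unfolding inj_def by (metis linorder_neqE_nat)
  define c where "c = (h ^^ i) undefined"
  have "(h ^^ (j - i)) c = (h ^^ (j - i + i)) undefined" unfolding funpow_add by (simp add: c_def)
  then have "(h ^^ (j - i)) c = c" using ij by (simp add: c_def)
  then have fix_pt: "(h ^^ (\<kappa> * (j - i))) c = c"
    by (induction \<kappa>) (auto simp: funpow_add)
  obtain v where v: "v \<in> level (\<kappa> * (j - i)) [c]" "hd v = c" using word fix_pt by metis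
  \<comment> \<open>The multiple \<open>\<kappa> * (j - i)\<close> of the period is large enough for mixing, which supplies a second letter.\<close>
  have "1 \<le> j - i" using ij(1) by simp
  then have "\<kappa> \<le> \<kappa> * (j - i)" by simp
  from level_mixing(2)[OF this v(1)] obtain d r where "v = c # d # r"
    using v(2) by (cases v; cases "tl v") auto
  then show ?thesis using v(1) ij(1) mixing_exponent_pos by (metis mult_pos_pos zero_less_diff)
qed

text \<open>Legality is witnessed by some letter at some level; mixing makes the witness uniform over the
  letter and over all large levels.\<close>
lemma legal_in_deep_levels:
  assumes "legal v"
  shows "\<exists>J. \<forall>j\<ge>J. \<forall>b. \<exists>v'\<in>level j [b]. sublist v v'"
proof -
  obtain c k v' where v': "v' \<in> level k [c]" "sublist v v'" using assms by (auto simp: legal_def)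
  have "\<exists>v'\<in>level j [b]. sublist v v'" if "j \<ge> \<kappa> + k" for j b
  proof -
    obtain y where y: "y \<in> level (j - k) [b]" using level_ex by blast
    have "c \<in> set y" using level_mixing(1)[OF _ y, of c] that by simp
    then have "sublist [c] y" by (auto simp: sublist_def dest: split_list)
    then obtain x where x: "x \<in> level k y" "sublist v' x" using level_sublist[OF v'(1)] by blast
    have "x \<in> level (k + (j - k)) [b]" using level_transitive[OF y x(1)] .
    then show ?thesis using that v'(2) x(2) sublist_order.order.trans by auto
  qed
  then show ?thesis by blast
qed

lemma legal_extension:
  assumes "legal y"
  shows "\<exists>s. legal (y @ s @ [b])"
proof -
  obtain c k d r where cdr: "c # d # r \<in> level k [c]" using returning_letter by blast
  obtain J where J: "\<And>j b. j \<ge> J \<Longrightarrow> \<exists>v'\<in>level j [b]. sublist y v'"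
    using legal_in_deep_levels[OF assms] by blast
  define j where "j = max J \<kappa>"
  obtain y' where y': "y' \<in> level j [c]" "sublist y y'" using J[of j c] by (auto simp: j_def)
  obtain s\<^sub>1 s\<^sub>2 where s: "y' = s\<^sub>1 @ y @ s\<^sub>2" using y'(2) by (auto simp: sublist_def)
  obtain z where z: "z \<in> level j [d]" using level_ex by blast
  have "b \<in> set z" using level_mixing(1)[OF _ z] by (simp add: j_def)
  then obtain t\<^sub>1 t\<^sub>2 where t: "z = t\<^sub>1 @ [b] @ t\<^sub>2" by (auto dest: split_list)
  obtain x where x: "x \<in> level j r" using level_ex by blast
  have "y' @ z @ x \<in> level j ([c] @ [d] @ r)" by (intro level_appendI y'(1) z x)
  then have "y' @ z @ x \<in> level (j + k) [c]" using level_transitive[OF cdr] by simp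
  then have "legal (y' @ z @ x)" unfolding legal_def by blast
  moreover have "y' @ z @ x = s\<^sub>1 @ (y @ (s\<^sub>2 @ t\<^sub>1) @ [b]) @ t\<^sub>2 @ x" using s t by simp
  ultimately have "legal (y @ (s\<^sub>2 @ t\<^sub>1) @ [b])"
    by (metis legal_sublist sublist_appendI)
  then show ?thesis by blast
qed

text \<open>By induction on \<open>F\<close>: append to \<open>y\<close> a further letter that inflates to the new word. The word
  \<open>y\<close> must contain one letter for each word of \<open>F\<close>, since a single realization of the random
  substitution chooses only one image for each letter occurrence.\<close>
lemma universal_word:
  assumes "finite F" "F \<subseteq> (\<Union>b. level n [b])"
  shows "\<exists>y V. legal y \<and> V \<in> level n y \<and>
    (\<forall>v\<in>F. \<exists>y\<^sub>1 V\<^sub>1. prefix y\<^sub>1 y \<and> V\<^sub>1 \<in> level n y\<^sub>1 \<and> prefix (V\<^sub>1 @ v) V)"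
  using assms
proof (induction F)
  case empty
  have "legal []" unfolding legal_def using level_ex sublist_Nil_left by blast
  then show ?case by (intro exI[of _ "[]"]) auto
next
  case (insert v F)
  obtain y V where yV: "legal y" "V \<in> level n y"
    "\<And>v. v \<in> F \<Longrightarrow> \<exists>y\<^sub>1 V\<^sub>1. prefix y\<^sub>1 y \<and> V\<^sub>1 \<in> level n y\<^sub>1 \<and> prefix (V\<^sub>1 @ v) V"
    using insert by auto
  obtain b where b: "v \<in> level n [b]" using insert.prems by auto
  obtain s where s: "legal (y @ s @ [b])" using legal_extension[OF yV(1)] by blast
  obtain S where S: "S \<in> level n s" using level_ex by blast
  have mem: "V @ S @ v \<in> level n (y @ s @ [b])" by (intro level_appendI yV(2) S b)
  have "\<exists>y\<^sub>1 V\<^sub>1. prefix y\<^sub>1 (y @ s @ [b]) \<and> V\<^sub>1 \<in> level n y\<^sub>1 \<and> prefix (V\<^sub>1 @ u) (V @ S @ v)"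
    if u: "u \<in> insert v F" for u
  proof (cases "u = v")
    case True
    have "V @ S \<in> level n (y @ s)" by (intro level_appendI yV(2) S)
    then show ?thesis using True by (intro exI[of _ "y @ s"] exI[of _ "V @ S"]) auto
  next
    case False
    then obtain y\<^sub>1 V\<^sub>1 where "prefix y\<^sub>1 y" "V\<^sub>1 \<in> level n y\<^sub>1" "prefix (V\<^sub>1 @ u) V"
      using yV(3) u by blast
    then show ?thesis by (intro exI[of _ y\<^sub>1] exI[of _ V\<^sub>1]) (auto intro: prefix_prefix)
  qed
  then show ?case using s mem by blast
qed

end

section \<open>Sequences with infinitely iterated preimages\<close>

lemma length_le_concat: "(\<And>v. v \<in> set g \<Longrightarrow> v \<noteq> []) \<Longrightarrow> length g \<le> length (concat g)"
proof (induction g)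
  case (Cons v g)
  have "1 \<le> length v" using Cons.prems[of v] by (cases v) auto
  then show ?case using Cons by simp
qed simp

lemma length_concat_le: "(\<And>v. v \<in> set g \<Longrightarrow> length v \<le> K) \<Longrightarrow> length (concat g) \<le> length g * K"
  by (induction g) (auto simp: add_mono)

context substitution_family
begin

text \<open>A property that implies membership in the shift and is inherited by some preimage, so that it
  implies membership in \<open>rsubst_shift_infinity\<close>. The definition asks for realizations of
  arbitrarily large level extending the prefixes.\<close>
definition deep :: "(nat \<Rightarrow> 'a) \<Rightarrow> bool" where
  "deep x \<longleftrightarrow> (\<forall>n. \<exists>b k v. n \<le> k \<and> v \<in> level k [b] \<and> prefix (seq_prefix x n) v)"

lemma deep_in_shift:
  assumes "deep x"
  shows "x \<in> rsubst_shift (enveloping \<Theta>)"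
  unfolding rsubst_shift_iff
proof (intro allI)
  fix i j
  obtain b k v where v: "v \<in> level k [b]" "prefix (seq_prefix x j) v"
    using assms unfolding deep_def by blast
  have "legal v" using v(1) unfolding legal_def by blast
  then have "legal (seq_prefix x j)" using v(2) legal_prefix by blast
  moreover have "sublist (map x [i..<j]) (seq_prefix x j)"
  proof (cases "i \<le> j")
    case True
    then show ?thesis using seq_prefix_add[of x i "j - i"] by simp
  qed simp
  ultimately show "legal (map x [i..<j])" using legal_sublist by blast
qed

text \<open>For each \<open>n\<close> a long prefix of \<open>w\<close> is cut into at least \<open>n\<close> blocks, and a limit of the
  pairs (letter, block) along a subsequence gives the preimage together with the images of
  its letters.\<close>
lemma deep_desubstitute:
  assumes "deep w"
  shows "\<exists>x. deep x \<and> w \<in> rsubst_seq (enveloping \<Theta>) x"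
proof -
  have "\<exists>b k y g. n \<le> k \<and> y \<in> level k [b] \<and> list_all2 (\<lambda>v c. v \<in> enveloping \<Theta> c) g y \<and>
      prefix (seq_prefix w (Suc n * maxlen)) (concat g) \<and> n \<le> length y" for n
  proof -
    \<comment> \<open>Blocks have length at most \<open>maxlen\<close>, so a prefix of length \<open>?m\<close> meets more than \<open>n\<close> of them.\<close>
    let ?m = "Suc n * maxlen"
    obtain b k v where v: "?m \<le> k" "v \<in> level k [b]" "prefix (seq_prefix w ?m) v"
      using assms unfolding deep_def by blast
    have "Suc n \<le> ?m" using mult_le_mono2[OF maxlen_pos, of "Suc n"] by simp
    then have k: "k = Suc (k - 1)" "n \<le> k - 1" using v(1) by auto
    have "v \<in> level (Suc (k - 1)) [b]" using v(2) k(1) by simp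
    then obtain y where y: "y \<in> level (k - 1) [b]" "v \<in> rsubst_word (enveloping \<Theta>) y"
      by (auto simp: level_Suc)
    obtain g where g: "list_all2 (\<lambda>v c. v \<in> enveloping \<Theta> c) g y" "v = concat g"
      using y(2) by (auto simp: rsubst_word_blocks)
    have "length u \<le> maxlen" if "u \<in> set g" for u
      using g(1) that image_length_le
      by (fastforce simp: list_all2_conv_all_nth in_set_conv_nth mem_enveloping)
    then have "length v \<le> length y * maxlen"
      using length_concat_le[of g maxlen] g by (simp add: list_all2_lengthD)
    moreover have "?m \<le> length v" using prefix_length_le[OF v(3)] by simp
    ultimately have "Suc n * maxlen \<le> length y * maxlen" by simp
    then have "Suc n \<le> length y" using maxlen_pos by (simp only: mult_le_cancel2)
    then show ?thesis using k(2) y(1) g v(3) by (intro exI[of _ b] exI[of _ "k - 1"] exI[of _ y] exI[of _ g]) auto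
  qed
  then obtain b k Y G where YG: "\<And>n. n \<le> k n" "\<And>n. Y n \<in> level (k n) [b n]"
    "\<And>n. list_all2 (\<lambda>v c. v \<in> enveloping \<Theta> c) (G n) (Y n)"
    "\<And>n. prefix (seq_prefix w (Suc n * maxlen)) (concat (G n))" "\<And>n. n \<le> length (Y n)"
    by metis
  have lenG: "length (G n) = length (Y n)" for n using YG(3) by (rule list_all2_lengthD)
  define F where "F = (SIGMA c:UNIV. enveloping \<Theta> c)"
  obtain \<theta> where \<theta>: "\<theta> \<in> \<Theta>" using family_nonempty by auto
  define f where "f n i = (if i < n then (Y n ! i, G n ! i) else (undefined, \<theta> undefined))" for n i
  have finF: "finite F" using family_finite by (simp add: F_def enveloping_def)
  have fF: "f n i \<in> F" for n i
    using YG(3)[of n] YG(5)[of n] \<theta> by (auto simp: f_def F_def mem_enveloping list_all2_conv_all_nth)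
  obtain l where l: "\<And>N. \<exists>n\<ge>N. \<forall>i<N. f n i = l i"
    using finite_alphabet_limit[of F f, OF finF fF] by metis
  define x where "x i = fst (l i)" for i
  define v where "v i = snd (l i)" for i
  have approx: "\<exists>n\<ge>N. seq_prefix x N = take N (Y n) \<and> seq_prefix v N = take N (G n)" for N
  proof -
    obtain n where n: "n \<ge> N" "\<forall>i<N. f n i = l i" using l by blast
    have "Y n ! i = x i \<and> G n ! i = v i" if "i < N" for i
    proof -
      have "f n i = l i" using n(2) that by blast
      moreover have "f n i = (Y n ! i, G n ! i)" using that n(1) by (simp add: f_def)
      ultimately show ?thesis by (simp add: x_def v_def prod_eq_iff)
    qed
    then have "seq_prefix x N = take N (Y n) \<and> seq_prefix v N = take N (G n)"
      using n(1) YG(5)[of n] lenG[of n] by (auto simp: list_eq_iff_nth_eq)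
    then show ?thesis using n(1) by blast
  qed
  have vx: "v i \<in> enveloping \<Theta> (x i)" for i
  proof -
    obtain n where "f n i = l i" using l[of "Suc i"] by blast
    then have "(x i, v i) \<in> F" using fF[of n i] by (simp add: x_def v_def)
    then show ?thesis by (simp add: F_def)
  qed
  have "deep x"
    unfolding deep_def
  proof
    fix N
    obtain n where n: "n \<ge> N" "seq_prefix x N = take N (Y n)" using approx by blast
    then have "prefix (seq_prefix x N) (Y n)" by (simp add: take_is_prefix)
    moreover have "N \<le> k n" using n(1) YG(1)[of n] by simp
    ultimately show "\<exists>b k v. N \<le> k \<and> v \<in> level k [b] \<and> prefix (seq_prefix x N) v"
      using YG(2)[of n] by blast
  qed
  moreover have "w = seq_concat v"
  proof
    fix i
    obtain n where n: "n \<ge> Suc i" "seq_prefix v (Suc i) = take (Suc i) (G n)" using approx by blast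
    have ne: "u \<noteq> []" if "u \<in> set (map v [0..<Suc i])" for u
      using that vx image_nonempty by (auto simp: mem_enveloping simp del: upt_Suc) metis
    have "i < length (concat (map v [0..<Suc i]))"
      using length_le_concat[of "map v [0..<Suc i]", OF ne] by (simp only: length_map length_upt Suc_le_eq diff_zero)
    moreover have "prefix (concat (map v [0..<Suc i])) (concat (G n))"
      using n(2) unfolding seq_prefix_def by (metis append_take_drop_id concat_append prefixI)
    ultimately have "seq_concat v i = concat (G n) ! i"
      unfolding seq_concat_def by (auto simp: prefix_def nth_append simp del: upt_Suc)
    moreover have "i < Suc n * maxlen"
    proof -
      have "Suc n \<le> Suc n * maxlen" using mult_le_mono2[OF maxlen_pos, of "Suc n"] by simp
      then show ?thesis using n(1) by linarith
    qed
    then have "w i = concat (G n) ! i"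
      using YG(4)[of n] nth_seq_prefix[of i "Suc n * maxlen" w]
      by (auto simp: prefix_def nth_append simp del: mult_Suc nth_seq_prefix)
    ultimately show "w i = seq_concat v i" by simp
  qed
  ultimately show ?thesis using vx unfolding rsubst_seq_def by blast
qed

lemma deep_in_shift_infinity:
  assumes "deep w"
  shows "w \<in> rsubst_shift_infinity (enveloping \<Theta>)"
proof -
  have "w \<in> (rsubst_seqs (enveloping \<Theta>) ^^ n) (rsubst_shift (enveloping \<Theta>))" for n
    using assms
  proof (induction n arbitrary: w)
    case (Suc n)
    obtain x where "deep x" "w \<in> rsubst_seq (enveloping \<Theta>) x" using deep_desubstitute[OF Suc.prems] by blast
    with Suc.IH[of x] show ?case by (auto simp: rsubst_seqs_def)
  qed (simp add: deep_in_shift)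
  then show ?thesis by (simp add: rsubst_shift_infinity_def)
qed

end

context mixing_family
begin

text \<open>Raising the level by multiples of \<open>k\<close> keeps \<open>u\<close> as a prefix, because the letter \<open>c\<close> returns as
  a first letter; once the level is large enough, the inflation of the second letter \<open>d\<close> can be
  chosen to contain \<open>v\<close>.\<close>
lemma returning_extension:
  assumes cdr: "0 < k" "c # d # r \<in> level k [c]" and u: "u \<in> level j [c]" and v: "legal v"
  shows "\<exists>j' u'. j < j' \<and> u' \<in> level j' [c] \<and> prefix u u' \<and> length u < length u' \<and> sublist v u'"
proof -
  have step: "u @ z \<in> level (j + k) [c]" if "u \<in> level j [c]" "z \<in> level j (d # r)" for u z j
  proof -
    have "u @ z \<in> level j ([c] @ d # r)" by (rule level_appendI[OF that])
    then show ?thesis using level_transitive[OF cdr(2)] by simp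
  qed
  obtain J where J: "\<And>j b. j \<ge> J \<Longrightarrow> \<exists>v'\<in>level j [b]. sublist v v'"
    using legal_in_deep_levels[OF v] by blast
  have "\<exists>u\<^sub>1\<in>level (j + s * k) [c]. prefix u u\<^sub>1" for s
  proof (induction s)
    case (Suc s)
    then obtain u\<^sub>1 where u1: "u\<^sub>1 \<in> level (j + s * k) [c]" "prefix u u\<^sub>1" by blast
    obtain z where "z \<in> level (j + s * k) (d # r)" using level_ex by blast
    from step[OF u1(1) this] show ?case
      using u1(2) by (intro bexI[of _ "u\<^sub>1 @ z"]) (auto simp: algebra_simps intro: prefix_prefix)
  qed (use u in auto)
  then obtain u\<^sub>1 where u1: "u\<^sub>1 \<in> level (j + J * k) [c]" "prefix u u\<^sub>1" by blast
  have "J \<le> j + J * k" using cdr(1) by (cases k) auto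
  from J[OF this] obtain v' where v': "v' \<in> level (j + J * k) [d]" "sublist v v'" by blast
  obtain z where z: "z \<in> level (j + J * k) r" using level_ex by blast
  have "v' @ z \<in> level (j + J * k) (d # r)" using level_appendI[OF v'(1) z] by simp
  from step[OF u1(1) this] have "u\<^sub>1 @ v' @ z \<in> level (j + J * k + k) [c]" .
  moreover have "length u < length (u\<^sub>1 @ v' @ z)"
    using level_length[OF v'(1)] prefix_length_le[OF u1(2)] by simp
  moreover have "sublist v (u\<^sub>1 @ v' @ z)"
    using v'(2) by (auto simp: sublist_def) (metis append.assoc)
  ultimately show ?thesis
    using cdr(1) u1(2) by (intro exI[of _ "j + J * k + k"] exI[of _ "u\<^sub>1 @ v' @ z"]) (auto intro: prefix_prefix)
qed

text \<open>Enumerate all words and treat the \<open>n\<close>-th one, when legal, in step \<open>n\<close>.\<close>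
lemma universal_deep_sequence: "\<exists>w. deep w \<and> (\<forall>v. legal v \<longrightarrow> occurs v w)"
proof -
  obtain c k d r where cdr: "0 < k" "c # d # r \<in> level k [c]" using returning_letter by blast
  have legalc: "legal [c]" unfolding legal_def by (intro exI[of _ c] exI[of _ 0]) auto
  have "\<exists>f. \<forall>n. (snd (f n) \<in> level (fst (f n)) [c]) \<and>
    (fst (f n) < fst (f (Suc n)) \<and> prefix (snd (f n)) (snd (f (Suc n))) \<and>
     length (snd (f n)) < length (snd (f (Suc n))) \<and>
     (legal (from_nat n) \<longrightarrow> sublist (from_nat n) (snd (f (Suc n)))))"
  proof (rule dependent_nat_choice)
    show "\<exists>x. snd x \<in> level (fst x) [c]" by (intro exI[of _ "(0, [c])"]) simp
    fix x :: "nat \<times> 'a list" and n assume x: "snd x \<in> level (fst x) [c]"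
    define v where "v = (if legal (from_nat n) then from_nat n else [c])"
    have "legal v" using legalc by (simp add: v_def)
    from returning_extension[OF cdr x this] obtain j' u' where
      "fst x < j'" "u' \<in> level j' [c]" "prefix (snd x) u'" "length (snd x) < length u'" "sublist v u'"
      by blast
    then show "\<exists>y. snd y \<in> level (fst y) [c] \<and> fst x < fst y \<and> prefix (snd x) (snd y) \<and>
        length (snd x) < length (snd y) \<and> (legal (from_nat n) \<longrightarrow> sublist (from_nat n) (snd y))"
      by (intro exI[of _ "(j', u')"]) (auto simp: v_def)
  qed
  then obtain f where f: "\<And>n. snd (f n) \<in> level (fst (f n)) [c]" "\<And>n. fst (f n) < fst (f (Suc n))"
    "\<And>n. prefix (snd (f n)) (snd (f (Suc n)))" "\<And>n. length (snd (f n)) < length (snd (f (Suc n)))"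
    "\<And>n. legal (from_nat n) \<Longrightarrow> sublist (from_nat n) (snd (f (Suc n)))" by metis
  have fst_ge: "n \<le> fst (f n)" for n
  proof (induction n)
    case (Suc n) then show ?case using f(2)[of n] by linarith
  qed simp
  have len_ge: "n \<le> length (snd (f n))" for n
  proof (induction n)
    case (Suc n) then show ?case using f(4)[of n] by linarith
  qed simp
  have "\<exists>!w. \<forall>n. seq_prefix w (length (snd (f n))) = snd (f n)"
  proof (rule nested_words_limit)
    show "prefix (snd (f n)) (snd (f (Suc n)))" for n by (rule f(3))
    show "\<exists>n. N \<le> length (snd (f n))" for N using len_ge by (rule exI)
  qed
  then obtain w where w: "\<And>n. seq_prefix w (length (snd (f n))) = snd (f n)" by blast
  have "deep w"
    unfolding deep_def
  proof
    fix n
    have "prefix (seq_prefix w n) (snd (f n))"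
      using prefix_seq_prefix[OF len_ge, of w n] w[of n] by simp
    then show "\<exists>b k v. n \<le> k \<and> v \<in> level k [b] \<and> prefix (seq_prefix w n) v"
      using fst_ge[of n] f(1)[of n] by blast
  qed
  moreover have "occurs v w" if "legal v" for v
  proof -
    have "sublist v (snd (f (Suc (to_nat v))))" using f(5)[of "to_nat v"] that by simp
    then have "sublist v (seq_prefix w (length (snd (f (Suc (to_nat v))))))" by (simp only: w)
    then show ?thesis by (rule occurs_sublist)
  qed
  ultimately show ?thesis by blast
qed

text \<open>A legal word is the beginning of an element of the shift: shift the sequence of
  \<open>universal_deep_sequence\<close> to an occurrence of the word.\<close>
lemma dense_orbit_iff_universal:
  "dense_orbit_in w (rsubst_shift (enveloping \<Theta>)) \<longleftrightarrow> (\<forall>v. legal v \<longrightarrow> occurs v w)"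
  unfolding dense_orbit_iff
proof safe
  fix v assume dense: "\<forall>x\<in>rsubst_shift (enveloping \<Theta>). \<forall>N. \<exists>n. \<forall>i<N. w (n + i) = x i" and v: "legal v"
  obtain w\<^sub>0 where w0: "deep w\<^sub>0" "occurs v w\<^sub>0" using universal_deep_sequence v by blast
  obtain m where m: "map w\<^sub>0 [m..<m + length v] = v" using w0(2) by (auto simp: occurs_def)
  define x where "x i = w\<^sub>0 (m + i)" for i
  have "map x [i..<j] = map w\<^sub>0 [m + i..<m + j]" for i j
    by (rule nth_equalityI) (auto simp: x_def algebra_simps)
  then have "x \<in> rsubst_shift (enveloping \<Theta>)"
    using deep_in_shift[OF w0(1)] by (simp add: rsubst_shift_iff)
  then obtain n where n: "\<forall>i<length v. w (n + i) = x i" using dense by blast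
  have "map w [n..<n + length v] = map w\<^sub>0 [m..<m + length v]"
    using n by (intro nth_equalityI) (auto simp: x_def)
  then show "occurs v w" using m by (auto simp: occurs_def)
next
  fix x N assume u: "\<forall>v. legal v \<longrightarrow> occurs v w" and x: "x \<in> rsubst_shift (enveloping \<Theta>)"
  have "occurs (map x [0..<N]) w" using u x by (simp add: rsubst_shift_iff)
  then obtain m where m: "map w [m..<m + N] = map x [0..<N]" by (auto simp: occurs_def)
  have "w (m + i) = x i" if "i < N" for i
    using arg_cong[OF m, of "\<lambda>l. l ! i"] that by simp
  then show "\<exists>n. \<forall>i<N. w (n + i) = x i" by blast
qed

end

section \<open>Digit expansions\<close>

lemma pf_projection_add: "pf_projection L R (x + y) = pf_projection L R x + pf_projection L R y"
  by (simp add: pf_projection_def inner_add_right add_divide_distrib scaleR_left_distrib)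

lemma pf_projection_idem: "L \<bullet> R \<noteq> 0 \<Longrightarrow> pf_projection L R (pf_projection L R x) = pf_projection L R x"
  by (simp add: pf_projection_def inner_diff_right)

text \<open>An edge of the prefix automaton, from \<open>c'\<close> down to \<open>c\<close>, with label \<open>p\<close>.\<close>
definition edge :: "('a \<Rightarrow> 'a list) set \<Rightarrow> 'a list \<Rightarrow> 'a \<Rightarrow> 'a \<Rightarrow> bool" where
  "edge T p c c' \<longleftrightarrow> (\<exists>\<theta>\<in>T. prefix (p @ [c]) (\<theta> c'))"

locale contracting_family = mixing_family +
  fixes L R :: "real^'a" and C \<rho> :: real
  assumes LR: "L \<bullet> R \<noteq> 0"
    and projection_commutes: "pf_projection L R (A *v x) = A *v pf_projection L R x"
    and contraction: "norm (((*v) A ^^ n) (pf_projection L R x)) \<le> C * \<rho> ^ n * norm x"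
    and rate: "0 < \<rho>" "\<rho> < 1"
begin

text \<open>The contribution of \<open>x\<close> at level \<open>n\<close> of a digit expansion. As the projection commutes with \<open>A\<close>, it
  is also the projection of \<open>A^n x\<close>.\<close>
definition D :: "nat \<Rightarrow> real^'a \<Rightarrow> real^'a" where
  "D n x = ((*v) A ^^ n) (pf_projection L R x)"

lemma D_0: "D 0 x = pf_projection L R x"
  by (simp add: D_def)

lemma D_add: "D n (x + y) = D n x + D n y"
proof -
  have "((*v) A ^^ n) (x + y) = ((*v) A ^^ n) x + ((*v) A ^^ n) y" for x y
    by (induction n) (auto simp: matrix_vector_right_distrib)
  then show ?thesis by (simp add: D_def pf_projection_add)
qed

lemma D_zero [simp]: "D n 0 = 0"
  using D_add[of n 0 0] by simp

lemma D_matrix: "D n (A *v x) = D (Suc n) x"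
  by (simp add: D_def projection_commutes funpow_swap1)

lemma D_level: "v \<in> level k u \<Longrightarrow> D n (abelianization v) = D (n + k) (abelianization u)"
proof (induction k arbitrary: v n)
  case (Suc k)
  then obtain y where y: "y \<in> level k u" "v \<in> rsubst_word (enveloping \<Theta>) y" by (auto simp: level_Suc)
  then show ?case using Suc.IH[OF y(1), of "Suc n"] rsubst_word_abelianization_length[OF y(2)]
    by (simp add: D_matrix)
qed simp

lemma D_bound: "norm (D n x) \<le> C * \<rho> ^ n * norm x"
  unfolding D_def by (rule contraction)

lemma C_nonneg: "0 \<le> C"
proof -
  have "0 \<le> C * norm (axis undefined 1 :: real^'a)"
    using order_trans[OF norm_ge_zero D_bound[of 0 "axis undefined 1"]] by simp
  then show ?thesis by (simp add: norm_axis_1)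
qed

lemma D_word_bound: "norm (D n (abelianization u)) \<le> C * \<rho> ^ n * length u"
  by (rule order_trans[OF D_bound mult_left_mono[OF norm_abelianization_le]])
    (simp add: C_nonneg rate less_imp_le)

text \<open>For abelianizations of long words, whose projections stay bounded (\<open>bounded_discrepancy\<close>) while
  they themselves do not.\<close>
lemma D_bound_projection: "norm (D n x) \<le> C * \<rho> ^ n * norm (D 0 x)"
  using contraction[of n "pf_projection L R x"] by (simp add: D_def pf_projection_idem[OF LR])

definition digit_const :: real where
  "digit_const = C * maxlen"

lemma digit_const_nonneg: "0 \<le> digit_const"
  by (simp add: digit_const_def C_nonneg)

lemma D_short_bound:
  assumes "length p \<le> maxlen"
  shows "norm (D n (abelianization p)) \<le> digit_const * \<rho> ^ n"
proof -
  have "C * \<rho> ^ n * length p \<le> C * \<rho> ^ n * maxlen"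
    using assms C_nonneg rate by (intro mult_left_mono) auto
  then show ?thesis using D_word_bound[of n p] by (simp add: digit_const_def mult_ac)
qed

lemma edge_length: "T \<subseteq> \<Theta> \<Longrightarrow> edge T p c c' \<Longrightarrow> length p \<le> maxlen"
proof -
  assume "T \<subseteq> \<Theta>" "edge T p c c'"
  then obtain \<theta> where \<theta>: "\<theta> \<in> \<Theta>" "prefix (p @ [c]) (\<theta> c')" by (auto simp: edge_def)
  show "length p \<le> maxlen"
    using prefix_length_le[OF \<theta>(2)] image_length_le[OF \<theta>(1), of c'] by simp
qed

text \<open>The geometric series bounds the digits of a prefix of an inflated letter; the additional
  summand accounts for a remaining single letter at level zero.\<close>
definition discrepancy_const :: real where
  "discrepancy_const = digit_const + digit_const / (1 - \<rho>)"

lemma geometric_tail: "(\<Sum>i\<in>{m..<n}. digit_const * \<rho> ^ i) \<le> digit_const * \<rho> ^ m / (1 - \<rho>)"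
proof (cases "m \<le> n")
  case True
  have "(1 - \<rho>) * (\<Sum>i\<in>{m..<n}. \<rho> ^ i) = \<rho> ^ m - \<rho> ^ n"
    using True
  proof (induction n rule: dec_induct)
    case (step n)
    have "(1 - \<rho>) * (\<Sum>i\<in>{m..<Suc n}. \<rho> ^ i) = (1 - \<rho>) * (\<Sum>i\<in>{m..<n}. \<rho> ^ i) + (1 - \<rho>) * \<rho> ^ n"
      using step(1) by (simp add: distrib_left)
    then show ?case unfolding step.IH by (simp add: algebra_simps)
  qed simp
  then have "(\<Sum>i\<in>{m..<n}. \<rho> ^ i) = (\<rho> ^ m - \<rho> ^ n) / (1 - \<rho>)"
    using rate by (simp add: field_simps)
  also have "\<dots> \<le> \<rho> ^ m / (1 - \<rho>)" using rate by (simp add: divide_right_mono)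
  finally have "(\<Sum>i\<in>{m..<n}. \<rho> ^ i) \<le> \<rho> ^ m / (1 - \<rho>)" .
  from mult_left_mono[OF this digit_const_nonneg] show ?thesis by (simp add: sum_distrib_left)
qed (use digit_const_nonneg rate in simp)

text \<open>A prefix of an inflated letter has a finite digit expansion, and its digits are summed
  against the contraction.\<close>
lemma bounded_discrepancy:
  assumes "v \<in> level k [b]" "prefix q v"
  shows "norm (D 0 (abelianization q)) \<le> discrepancy_const"
proof -
  have "norm (D 0 (abelianization q)) \<le> digit_const + (\<Sum>i\<in>{0..<k}. digit_const * \<rho> ^ i)"
    using assms
  proof (induction k arbitrary: b v q)
    case 0
    then have "length q \<le> 1" using prefix_length_le[of q "[b]"] by simp
    then show ?case using D_short_bound[of q 0] maxlen_pos by simp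
  next
    case (Suc k)
    have "v \<in> level (k + Suc 0) [b]" using Suc.prems(1) by simp
    then obtain y where y: "y \<in> level (Suc 0) [b]" "v \<in> level k y" unfolding level_add by blast
    then obtain \<theta> where \<theta>: "\<theta> \<in> \<Theta>" "y = \<theta> b" by (auto simp: level_1 rsubst_word_Cons mem_enveloping)
    obtain u\<^sub>1 u\<^sub>2 x\<^sub>1 q' where *: "y = u\<^sub>1 @ u\<^sub>2" "x\<^sub>1 \<in> level k u\<^sub>1" "q = x\<^sub>1 @ q'"
      "q' = [] \<or> (\<exists>c v. v \<in> level k [c] \<and> prefix q' v)"
      using level_prefix_split[OF y(2) Suc.prems(2)] by blast
    have "length u\<^sub>1 \<le> maxlen" using *(1) \<theta> image_length_le[of \<theta> b] by simp
    then have 1: "norm (D 0 (abelianization x\<^sub>1)) \<le> digit_const * \<rho> ^ k"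
      using D_short_bound[of u\<^sub>1 k] by (simp add: D_level[OF *(2)])
    have 2: "norm (D 0 (abelianization q')) \<le> digit_const + (\<Sum>i\<in>{0..<k}. digit_const * \<rho> ^ i)"
      using *(4)
    proof
      assume "q' = []"
      then show ?thesis using digit_const_nonneg rate by (simp add: sum_nonneg)
    next
      assume "\<exists>c v. v \<in> level k [c] \<and> prefix q' v"
      then show ?thesis using Suc.IH by blast
    qed
    show ?case
      using norm_triangle_mono[OF 1 2] *(3) by (simp add: abelianization_append D_add)
  qed
  also have "\<dots> \<le> discrepancy_const" using geometric_tail[of 0 k] by (simp add: discrepancy_const_def)
  finally show ?thesis .
qed

text \<open>A factor is a difference of two prefixes.\<close>
lemma legal_discrepancy:
  assumes "legal u"
  shows "norm (D 0 (abelianization u)) \<le> 2 * discrepancy_const"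
proof -
  obtain b k v where v: "v \<in> level k [b]" "sublist u v" using assms by (auto simp: legal_def)
  obtain s t where st: "v = s @ u @ t" using v(2) by (auto simp: sublist_def)
  have "norm (D 0 (abelianization (s @ u))) \<le> discrepancy_const" "norm (D 0 (abelianization s)) \<le> discrepancy_const"
    using st by (auto intro!: bounded_discrepancy[OF v(1)])
  moreover have "D 0 (abelianization u) = D 0 (abelianization (s @ u)) - D 0 (abelianization s)"
    by (simp add: abelianization_append D_add)
  ultimately show ?thesis
    using norm_triangle_ineq4[of "D 0 (abelianization (s @ u))" "D 0 (abelianization s)"] by simp
qed

definition digit_sum :: "(nat \<Rightarrow> 'a list) \<Rightarrow> nat \<Rightarrow> real^'a" where
  "digit_sum p n = (\<Sum>i<n. D i (abelianization (p i)))"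

text \<open>The points of the infinite paths that end at \<open>a\<close> in the prefix automaton with edges
  \<open>edge (T i)\<close> at level \<open>i\<close>. For constant \<open>T\<close> these sets are the attractor of a graph-directed
  iterated function system.\<close>
definition digit_tile :: "(nat \<Rightarrow> ('a \<Rightarrow> 'a list) set) \<Rightarrow> 'a \<Rightarrow> (real^'a) set" where
  "digit_tile T a = {\<Sum>i. D i (abelianization (p i)) |p b. b 0 = a \<and> (\<forall>i. edge (T i) (p i) (b i) (b (Suc i)))}"

lemma digit_sum_0 [simp]: "digit_sum p 0 = 0"
  by (simp add: digit_sum_def)

lemma digit_sum_Suc: "digit_sum p (Suc n) = digit_sum p n + D n (abelianization (p n))"
  by (simp add: digit_sum_def)

lemma digit_sum_cong: "(\<And>i. i < n \<Longrightarrow> p i = p' i) \<Longrightarrow> digit_sum p n = digit_sum p' n"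
  by (simp add: digit_sum_def)

lemma digit_sum_diff_bound:
  assumes "\<And>i. i < n \<Longrightarrow> length (p i) \<le> maxlen" "m \<le> n"
  shows "norm (digit_sum p n - digit_sum p m) \<le> digit_const * \<rho> ^ m / (1 - \<rho>)"
proof -
  have "digit_sum p n - digit_sum p m = (\<Sum>i\<in>{m..<n}. D i (abelianization (p i)))"
    unfolding digit_sum_def using assms(2) by (simp add: sum_diff[symmetric] lessThan_minus_lessThan)
  also have "norm \<dots> \<le> (\<Sum>i\<in>{m..<n}. digit_const * \<rho> ^ i)"
    using assms(1) by (intro sum_norm_le D_short_bound) auto
  also have "\<dots> \<le> digit_const * \<rho> ^ m / (1 - \<rho>)" by (rule geometric_tail)
  finally show ?thesis .
qed

lemma digit_sum_converges:
  assumes "\<And>i. length (p i) \<le> maxlen"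
  shows "digit_sum p \<longlonglongrightarrow> (\<Sum>i. D i (abelianization (p i)))"
    and "norm ((\<Sum>i. D i (abelianization (p i))) - digit_sum p m) \<le> digit_const * \<rho> ^ m / (1 - \<rho>)"
proof -
  have "summable (\<lambda>i. digit_const * \<rho> ^ i)" using rate by (intro summable_mult summable_geometric) auto
  then have "summable (\<lambda>i. D i (abelianization (p i)))"
    by (rule summable_comparison_test'[where N = 0]) (rule D_short_bound[OF assms])
  from summable_LIMSEQ[OF this] show lim: "digit_sum p \<longlonglongrightarrow> (\<Sum>i. D i (abelianization (p i)))"
    unfolding digit_sum_def .
  have "(\<lambda>n. norm (digit_sum p n - digit_sum p m)) \<longlonglongrightarrow> norm ((\<Sum>i. D i (abelianization (p i))) - digit_sum p m)"
    by (intro tendsto_intros lim)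
  then show "norm ((\<Sum>i. D i (abelianization (p i))) - digit_sum p m) \<le> digit_const * \<rho> ^ m / (1 - \<rho>)"
    by (rule LIMSEQ_le_const2) (intro exI[of _ m] allI impI digit_sum_diff_bound assms)
qed

lemma geometric_bound_imp_zero:
  fixes z :: "real^'a"
  assumes "\<And>n. norm z \<le> c * \<rho> ^ n"
  shows "z = 0"
proof -
  have "(\<lambda>n. c * \<rho> ^ n) \<longlonglongrightarrow> c * 0"
    by (intro tendsto_mult_left LIMSEQ_power_zero) (use rate in auto)
  then have "norm z \<le> c * 0" by (rule LIMSEQ_le_const) (intro exI allI impI assms)
  then show ?thesis by simp
qed

text \<open>The finite addresses for different \<open>n\<close> may be unrelated to each other. A limit of them along a
  subsequence is an infinite address, and its point is \<open>y\<close> because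
  addresses that agree up to level \<open>N\<close> have points within a multiple of \<open>\<rho> ^ N\<close>.\<close>
lemma digit_tileI:
  assumes T: "\<And>i. T i \<subseteq> \<Theta>"
    and approx: "\<And>n. \<exists>p b. b 0 = a \<and> (\<forall>i<n. edge (T i) (p i) (b i) (b (Suc i))) \<and> norm (y - digit_sum p n) \<le> E * \<rho> ^ n"
  shows "y \<in> digit_tile T a"
proof -
  obtain P b' where P: "\<And>n. b' n 0 = a" "\<And>n i. i < n \<Longrightarrow> edge (T i) (P n i) (b' n i) (b' n (Suc i))"
    "\<And>n. norm (y - digit_sum (P n) n) \<le> E * \<rho> ^ n"
    using approx by metis
  define F where "F = {p :: 'a list. length p \<le> maxlen} \<times> (UNIV :: 'a set)"
  define f where "f n i = (if i < n then (P n i, b' n i) else ([], undefined))" for n i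
  have finF: "finite F"
    using finite_lists_length_le[of "UNIV :: 'a set" maxlen] by (simp add: F_def)
  have len: "length (P n i) \<le> maxlen" if "i < n" for n i
    using edge_length[OF T P(2)[OF that]] .
  have fF: "f n i \<in> F" for n i by (simp add: f_def F_def len)
  obtain l where l: "\<And>N. \<exists>n\<ge>N. \<forall>i<N. f n i = l i"
    using finite_alphabet_limit[of F f, OF finF fF] by metis
  define p where "p i = fst (l i)" for i
  define b where "b i = snd (l i)" for i
  have agree: "\<exists>n\<ge>N. \<forall>i<N. P n i = p i \<and> b' n i = b i" for N
  proof -
    obtain n where n: "n \<ge> N" "\<forall>i<N. f n i = l i" using l by blast
    have "P n i = p i \<and> b' n i = b i" if "i < N" for i
    proof -
      have "f n i = l i" using n(2) that by blast
      moreover have "f n i = (P n i, b' n i)" using that n(1) by (simp add: f_def)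
      ultimately show ?thesis by (simp add: p_def b_def prod_eq_iff)
    qed
    then show ?thesis using n(1) by blast
  qed
  have edges: "edge (T i) (p i) (b i) (b (Suc i))" for i
  proof -
    obtain n where n: "n \<ge> Suc (Suc i)" "\<forall>j<Suc (Suc i). P n j = p j \<and> b' n j = b j" using agree by blast
    have "P n i = p i" "b' n i = b i" "b' n (Suc i) = b (Suc i)" using n(2) by auto
    then show ?thesis using P(2)[of i n] n(1) by simp
  qed
  have b0: "b 0 = a" 
  proof -
    obtain n where "\<forall>i<1. P n i = p i \<and> b' n i = b i" using agree by blast
    then show ?thesis using P(1)[of n] by simp
  qed
  let ?e = "\<Sum>i. D i (abelianization (p i))"
  have lenp: "length (p i) \<le> maxlen" for i using edge_length[OF T edges] .
  have "norm (y - ?e) \<le> (\<bar>E\<bar> + 2 * digit_const / (1 - \<rho>)) * \<rho> ^ N" for N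
  proof -
    obtain n where n: "n \<ge> N" "\<forall>i<N. P n i = p i \<and> b' n i = b i" using agree by blast
    have eq: "digit_sum (P n) N = digit_sum p N" using n(2) by (intro digit_sum_cong) auto
    have "norm (y - digit_sum (P n) n) \<le> \<bar>E\<bar> * \<rho> ^ N"
    proof -
      have "E * \<rho> ^ n \<le> \<bar>E\<bar> * \<rho> ^ N"
        using rate n(1) by (intro mult_mono power_decreasing) auto
      then show ?thesis using P(3)[of n] by linarith
    qed
    moreover have "norm (digit_sum (P n) n - digit_sum (P n) N) \<le> digit_const * \<rho> ^ N / (1 - \<rho>)"
      using len n(1) by (intro digit_sum_diff_bound) auto
    moreover have "norm (?e - digit_sum p N) \<le> digit_const * \<rho> ^ N / (1 - \<rho>)" by (rule digit_sum_converges(2)[OF lenp])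
    moreover have "y - ?e = (y - digit_sum (P n) n) + (digit_sum (P n) n - digit_sum (P n) N) - (?e - digit_sum p N)"
      by (simp add: eq)
    ultimately have "norm (y - ?e) \<le> \<bar>E\<bar> * \<rho> ^ N + digit_const * \<rho> ^ N / (1 - \<rho>) + digit_const * \<rho> ^ N / (1 - \<rho>)"
      by (smt (verit) norm_triangle_ineq norm_triangle_ineq4)
    then show ?thesis by (simp add: algebra_simps)
  qed
  then have "y - ?e = 0" by (rule geometric_bound_imp_zero)
  then have "y = ?e" by simp
  then show ?thesis unfolding digit_tile_def using b0 edges by blast
qed

lemma digit_tileD:
  assumes "\<And>i. T i \<subseteq> \<Theta>" "y \<in> digit_tile T a"
  shows "\<exists>p b. b 0 = a \<and> (\<forall>i. edge (T i) (p i) (b i) (b (Suc i))) \<and> digit_sum p \<longlonglongrightarrow> y \<and>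
    (\<forall>n. norm (y - digit_sum p n) \<le> digit_const * \<rho> ^ n / (1 - \<rho>))"
proof -
  obtain p b where pb: "y = (\<Sum>i. D i (abelianization (p i)))" "b 0 = a"
    "\<And>i. edge (T i) (p i) (b i) (b (Suc i))" using assms(2) unfolding digit_tile_def by blast
  have "length (p i) \<le> maxlen" for i using edge_length[OF assms(1) pb(3)] .
  from digit_sum_converges[OF this] pb show ?thesis by (intro exI[of _ p] exI[of _ b]) auto
qed

lemma closed_digit_tile:
  assumes T: "\<And>i. T i \<subseteq> \<Theta>"
  shows "closed (digit_tile T a)"
  unfolding closure_subset_eq[symmetric]
proof
  fix y assume y: "y \<in> closure (digit_tile T a)"
  show "y \<in> digit_tile T a"
  proof (rule digit_tileI[OF T])
    fix n
    have "0 < \<rho> ^ n" using rate by simp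
    then obtain e where e: "e \<in> digit_tile T a" "dist e y < \<rho> ^ n"
      using y unfolding closure_approachable by blast
    obtain p b where pb: "b 0 = a" "\<And>i. edge (T i) (p i) (b i) (b (Suc i))"
      "norm (e - digit_sum p n) \<le> digit_const * \<rho> ^ n / (1 - \<rho>)"
      using digit_tileD[OF T e(1)] by blast
    have "norm (y - digit_sum p n) \<le> norm (y - e) + norm (e - digit_sum p n)"
      using norm_triangle_ineq[of "y - e" "e - digit_sum p n"] by simp
    also have "\<dots> \<le> (1 + digit_const / (1 - \<rho>)) * \<rho> ^ n"
      using e(2) pb(3) by (simp add: dist_norm norm_minus_commute algebra_simps)
    finally show "\<exists>p b. b 0 = a \<and> (\<forall>i<n. edge (T i) (p i) (b i) (b (Suc i))) \<and>
        norm (y - digit_sum p n) \<le> (1 + digit_const / (1 - \<rho>)) * \<rho> ^ n" using pb by blast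
  qed
qed

lemma bounded_digit_tile:
  assumes "\<And>i. T i \<subseteq> \<Theta>" "y \<in> digit_tile T a"
  shows "norm y \<le> digit_const / (1 - \<rho>)"
proof -
  obtain p where "norm (y - digit_sum p 0) \<le> digit_const * \<rho> ^ 0 / (1 - \<rho>)" using digit_tileD[OF assms] by blast
  then show ?thesis by simp
qed

end

section \<open>The subtiles of the random substitution\<close>

lemma seq_prefix_of_prefix: "seq_prefix w (length v) = v \<Longrightarrow> prefix u v \<Longrightarrow> seq_prefix w (length u) = u"
proof -
  assume v: "seq_prefix w (length v) = v" and u: "prefix u v"
  have "prefix (seq_prefix w (length u)) v"
    using prefix_seq_prefix[OF prefix_length_le[OF u], of w] v by simp
  with u show ?thesis by (metis prefix_same_cases prefix_length_prefix prefix_order.antisym length_seq_prefix order_refl)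
qed

lemma shift_prefix_append:
  assumes "map w [k..<k + length V] = V" "prefix (q @ [c]) V"
  shows "seq_prefix w (k + length q) = seq_prefix w k @ q" "w (k + length q) = c"
proof -
  obtain r where V: "V = q @ c # r" using assms(2) by (auto simp: prefix_def)
  have at: "w (k + i) = V ! i" if "i < length V" for i
    using arg_cong[OF assms(1), of "\<lambda>l. l ! i"] that by simp
  have "map w [k..<k + length q] = q"
    by (rule nth_equalityI) (simp_all add: at V nth_append)
  then show "seq_prefix w (k + length q) = seq_prefix w k @ q" by (simp add: seq_prefix_add)
  show "w (k + length q) = c" using at[of "length q"] by (simp add: V)
qed

lemma seq_subtile_eq:
  "seq_subtile L R w a = closure {pf_projection L R (abelianization (seq_prefix w m)) |m. w m = a}"
  unfolding seq_subtile_def letter_points_def by (rule arg_cong[of _ _ closure]) auto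

context substitution_family
begin

lemma mem_rsubst_seqs: "w \<in> rsubst_seqs \<phi> X \<longleftrightarrow> (\<exists>x\<in>X. w \<in> rsubst_seq \<phi> x)"
  by (simp add: rsubst_seqs_def)

lemma rsubst_seqs_chain:
  "w \<in> (rsubst_seqs \<phi> ^^ n) X \<Longrightarrow> \<exists>ws. ws 0 = w \<and> (\<forall>i<n. ws i \<in> rsubst_seq \<phi> (ws (Suc i)))"
proof (induction n arbitrary: w)
  case (Suc n)
  then obtain x where x: "x \<in> (rsubst_seqs \<phi> ^^ n) X" "w \<in> rsubst_seq \<phi> x"
    by (auto simp: mem_rsubst_seqs)
  obtain ws where ws: "ws 0 = x" "\<forall>i<n. ws i \<in> rsubst_seq \<phi> (ws (Suc i))" using Suc.IH[OF x(1)] by blast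
  have "(case i of 0 \<Rightarrow> w | Suc i \<Rightarrow> ws i) \<in> rsubst_seq \<phi> (ws i)" if "i < Suc n" for i
    using that x(2) ws by (cases i) auto
  then show ?case by (intro exI[of _ "case_nat w ws"]) auto
qed auto

lemma concat_blocks_abelianization:
  assumes "\<And>i. v i \<in> enveloping \<Theta> (x i)"
  shows "abelianization (concat (map v [0..<j])) = A *v abelianization (seq_prefix x j)"
proof -
  have "list_all2 (\<lambda>v c. v \<in> enveloping \<Theta> c) (map v [0..<j]) (seq_prefix x j)"
    by (auto simp: list_all2_conv_all_nth assms)
  then have "concat (map v [0..<j]) \<in> rsubst_word (enveloping \<Theta>) (seq_prefix x j)"
    unfolding rsubst_word_blocks by blast
  then show ?thesis using rsubst_word_abelianization_length by blast
qed

end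

context contracting_family
begin

text \<open>The digits are read off level by level from the blocks containing the position; only the
  remainder depends on the blocks in front.\<close>
lemma desubstitution_address:
  assumes T: "\<And>i. T i \<subseteq> \<Theta>"
  shows "(\<forall>i<n. ws i \<in> rsubst_seq (enveloping (T i)) (ws (Suc i))) \<Longrightarrow>
    \<exists>p b j. b 0 = ws 0 m \<and> b n = ws n j \<and> j \<le> m \<and> (\<forall>i<n. edge (T i) (p i) (b i) (b (Suc i))) \<and>
      D 0 (abelianization (seq_prefix (ws 0) m)) = digit_sum p n + D n (abelianization (seq_prefix (ws n) j))"
proof (induction n)
  case 0
  show ?case by (intro exI[of _ "\<lambda>_. []"] exI[of _ "\<lambda>_. ws 0 m"] exI[of _ m]) simp
next
  case (Suc n)
  obtain p b j where pb: "b 0 = ws 0 m" "b n = ws n j" "j \<le> m"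
    "\<forall>i<n. edge (T i) (p i) (b i) (b (Suc i))"
    "D 0 (abelianization (seq_prefix (ws 0) m)) = digit_sum p n + D n (abelianization (seq_prefix (ws n) j))"
    using Suc by auto
  obtain v where v: "ws n = seq_concat v" "\<And>i. v i \<in> enveloping (T n) (ws (Suc n) i)"
    using Suc.prems by (auto simp: rsubst_seq_def)
  have v': "v i \<in> enveloping \<Theta> (ws (Suc n) i)" for i
    using v(2)[of i] T[of n] by (auto simp: mem_enveloping)
  have ne: "v i \<noteq> []" for i using v'[of i] image_nonempty unfolding mem_enveloping by metis
  obtain j' q r where j': "j' \<le> j" "v j' = q @ ws n j # r"
    "seq_prefix (ws n) j = concat (map v [0..<j']) @ q"
    using seq_concat_position[of v j] ne unfolding v(1) by metis
  define p' where "p' = p(n := q)"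
  define b' where "b' = b(Suc n := ws (Suc n) j')"
  have "edge (T n) q (ws n j) (ws (Suc n) j')"
    using v(2)[of j'] j'(2) by (auto simp: edge_def mem_enveloping) (metis prefixI append_Cons append_assoc append_Nil)
  then have "edge (T i) (p' i) (b' i) (b' (Suc i))" if "i < Suc n" for i
    using that pb(2,4) by (cases "i = n") (auto simp: p'_def b'_def)
  moreover have "digit_sum p' (Suc n) = digit_sum p n + D n (abelianization q)"
    using digit_sum_cong[of n p' p] by (simp add: digit_sum_Suc p'_def)
  moreover have "D n (abelianization (seq_prefix (ws n) j)) =
      D (Suc n) (abelianization (seq_prefix (ws (Suc n)) j')) + D n (abelianization q)"
    unfolding j'(3) abelianization_append D_add concat_blocks_abelianization[of v "ws (Suc n)", OF v'] D_matrix ..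
  ultimately show ?case
    using pb(1,3,5) j'(1) by (intro exI[of _ p'] exI[of _ b'] exI[of _ j']) (auto simp: b'_def)
qed

text \<open>The remainder at level \<open>n\<close> is a prefix of length at most \<open>m\<close>, so it is contracted to zero.\<close>
lemma seq_subtile_subset:
  assumes T: "\<And>i. T i \<subseteq> \<Theta>"
    and chain: "\<And>n. \<exists>ws. ws 0 = w \<and> (\<forall>i<n. ws i \<in> rsubst_seq (enveloping (T i)) (ws (Suc i)))"
  shows "seq_subtile L R w a \<subseteq> digit_tile T a"
  unfolding seq_subtile_eq
proof (rule closure_minimal[OF _ closed_digit_tile[OF T]], safe)
  fix m
  show "pf_projection L R (abelianization (seq_prefix w m)) \<in> digit_tile T (w m)"
  proof (rule digit_tileI[OF T])
    fix n
    obtain ws where ws: "ws 0 = w" "\<forall>i<n. ws i \<in> rsubst_seq (enveloping (T i)) (ws (Suc i))"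
      using chain by blast
    obtain p b j where pb: "b 0 = w m" "j \<le> m" "\<forall>i<n. edge (T i) (p i) (b i) (b (Suc i))"
      "D 0 (abelianization (seq_prefix w m)) = digit_sum p n + D n (abelianization (seq_prefix (ws n) j))"
      using desubstitution_address[OF T ws(2), where m = m] unfolding ws(1) by blast
    have "norm (D n (abelianization (seq_prefix (ws n) j))) \<le> C * \<rho> ^ n * j"
      using D_word_bound[of n "seq_prefix (ws n) j"] by simp
    also have "\<dots> \<le> C * \<rho> ^ n * m"
      using pb(2) C_nonneg rate by (intro mult_left_mono) auto
    finally have "norm (pf_projection L R (abelianization (seq_prefix w m)) - digit_sum p n) \<le> (C * m) * \<rho> ^ n"
      using pb(4) by (simp add: D_0 mult_ac)
    then show "\<exists>p b. b 0 = w m \<and> (\<forall>i<n. edge (T i) (p i) (b i) (b (Suc i))) \<and>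
        norm (pf_projection L R (abelianization (seq_prefix w m)) - digit_sum p n) \<le> (C * m) * \<rho> ^ n"
      using pb by blast
  qed
qed

text \<open>Some realization of level \<open>n\<close> follows the address, since each letter of the word on
  the next level may be inflated independently of the others.\<close>
lemma address_realization:
  assumes "\<forall>i<n. edge \<Theta> (p i) (b i) (b (Suc i))"
  shows "\<exists>v q. v \<in> level n [b n] \<and> prefix (q @ [b 0]) v \<and> D 0 (abelianization q) = digit_sum p n"
  using assms
proof (induction n)
  case 0
  show ?case by (intro exI[of _ "[b 0]"] exI[of _ "[]"]) simp
next
  case (Suc n)
  then obtain v q where v: "v \<in> level n [b n]" "prefix (q @ [b 0]) v" "D 0 (abelianization q) = digit_sum p n"
    by auto
  obtain \<theta> where \<theta>: "\<theta> \<in> \<Theta>" "prefix (p n @ [b n]) (\<theta> (b (Suc n)))"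
    using Suc.prems by (auto simp: edge_def)
  then obtain r where r: "\<theta> (b (Suc n)) = p n @ [b n] @ r" by (auto simp: prefix_def)
  obtain x where x: "x \<in> level n (p n)" using level_ex by blast
  obtain z where z: "z \<in> level n r" using level_ex by blast
  have "\<theta> (b (Suc n)) \<in> level (Suc 0) [b (Suc n)]"
    using \<theta>(1) by (auto simp: level_1 rsubst_word_Cons mem_enveloping)
  moreover have "x @ v @ z \<in> level n (\<theta> (b (Suc n)))" unfolding r by (intro level_appendI x v(1) z)
  ultimately have "x @ v @ z \<in> level (n + Suc 0) [b (Suc n)]" by (rule level_transitive)
  moreover have "prefix ((x @ q) @ [b 0]) (x @ v @ z)"
    using v(2) by (auto simp: prefix_def)
  moreover have "D 0 (abelianization (x @ q)) = digit_sum p (Suc n)"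
    using D_level[OF x, of 0] v(3) by (simp add: abelianization_append D_add digit_sum_Suc)
  ultimately show ?case by (intro exI[of _ "x @ v @ z"] exI[of _ "x @ q"]) simp
qed

text \<open>The counterpart of \<open>desubstitution_address\<close> for a deterministic chain: a position on level \<open>n\<close>
  with the last letter of the address is carried down along the address.\<close>
lemma address_position:
  assumes \<theta>: "\<And>i. \<theta> i \<in> \<Theta>"
  shows "\<lbrakk>\<forall>i<n. ws i = seq_concat (\<lambda>j. \<theta> i (ws (Suc i) j));
      \<forall>i<n. prefix (p i @ [b i]) (\<theta> i (b (Suc i))); ws n j = b n\<rbrakk> \<Longrightarrow>
    \<exists>m. ws 0 m = b 0 \<and>
      D 0 (abelianization (seq_prefix (ws 0) m)) = digit_sum p n + D n (abelianization (seq_prefix (ws n) j))"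
proof (induction n arbitrary: j)
  case (Suc n)
  define v where "v j = \<theta> n (ws (Suc n) j)" for j
  have v: "v i \<in> enveloping \<Theta> (ws (Suc n) i)" for i using \<theta> by (auto simp: v_def mem_enveloping)
  have ne: "v i \<noteq> []" for i using image_nonempty[OF \<theta>] by (simp add: v_def)
  have ws: "ws n = seq_concat v" using Suc.prems(1) by (simp add: v_def[abs_def])
  have pre: "prefix (p n @ [b n]) (v j)" using Suc.prems(2,3) by (simp add: v_def)
  define q where "q = concat (map v [0..<j]) @ p n"
  note at = seq_concat_at[of v, OF ne pre, folded q_def ws]
  obtain m where m: "ws 0 m = b 0"
    "D 0 (abelianization (seq_prefix (ws 0) m)) = digit_sum p n + D n (abelianization (seq_prefix (ws n) (length q)))"
    using Suc.IH[of "length q"] Suc.prems at(2) by auto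
  have "D n (abelianization q) = D (Suc n) (abelianization (seq_prefix (ws (Suc n)) j)) + D n (abelianization (p n))"
    unfolding q_def abelianization_append D_add concat_blocks_abelianization[of v "ws (Suc n)", OF v] D_matrix ..
  then have "D 0 (abelianization (seq_prefix (ws 0) m)) =
      digit_sum p (Suc n) + D (Suc n) (abelianization (seq_prefix (ws (Suc n)) j))"
    using m(2) by (simp add: at(1) digit_sum_Suc)
  then show ?case using m(1) by blast
qed auto

lemma D_tendsto_zero:
  assumes "\<And>n. norm (D 0 (x n)) \<le> c"
  shows "(\<lambda>n. D n (x n)) \<longlonglongrightarrow> 0"
proof (rule Lim_null_comparison[of _ "\<lambda>n. C * \<rho> ^ n * c"])
  show "\<forall>\<^sub>F n in sequentially. norm (D n (x n)) \<le> C * \<rho> ^ n * c"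
    using C_nonneg rate
    by (intro always_eventually allI order_trans[OF D_bound_projection mult_left_mono[OF assms]]) simp
  have "(\<lambda>n. C * \<rho> ^ n * c) \<longlonglongrightarrow> C * 0 * c"
    by (intro tendsto_intros LIMSEQ_power_zero) (use rate in auto)
  then show "(\<lambda>n. C * \<rho> ^ n * c) \<longlonglongrightarrow> 0" by simp
qed

lemma shift_infinity_subset: "w \<in> rsubst_shift_infinity \<phi> \<Longrightarrow> w \<in> rsubst_shift \<phi>"
  unfolding rsubst_shift_infinity_def by (metis INT_E UNIV_I funpow_0)

text \<open>For each \<open>n\<close> the sequence \<open>w\<close> contains, at some place \<open>k n\<close>, a word in which all addresses of
  length \<open>n\<close> are realized simultaneously. The projected abelianizations of the prefixes of \<open>w\<close> of
  length \<open>k n\<close> are bounded, and the translation is one of their limit points. That all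
  addresses are realized next to the same place makes the translation independent of the point.\<close>
lemma translated_digit_tile_subset:
  assumes w: "w \<in> rsubst_shift (enveloping \<Theta>)" and dense: "\<And>v. legal v \<Longrightarrow> occurs v w"
  shows "\<exists>t. \<forall>e\<in>digit_tile (\<lambda>_. \<Theta>) a. t + e \<in> seq_subtile L R w a"
proof -
  have "\<exists>y V. legal y \<and> V \<in> level n y \<and>
    (\<forall>v\<in>(\<Union>b. level n [b]). \<exists>y\<^sub>1 V\<^sub>1. prefix y\<^sub>1 y \<and> V\<^sub>1 \<in> level n y\<^sub>1 \<and> prefix (V\<^sub>1 @ v) V)" for n
    by (rule universal_word) (auto intro: finite_level)
  then obtain y V where yV: "\<And>n. legal (y n)" "\<And>n. V n \<in> level n (y n)"
    "\<And>n v b. v \<in> level n [b] \<Longrightarrow> \<exists>y\<^sub>1 V\<^sub>1. prefix y\<^sub>1 (y n) \<and> V\<^sub>1 \<in> level n y\<^sub>1 \<and> prefix (V\<^sub>1 @ v) (V n)"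
    by (metis UN_I UNIV_I)
  have "\<exists>k. map w [k..<k + length (V n)] = V n" for n
    using dense[OF legal_level[OF yV(1) yV(2)]] by (simp add: occurs_def)
  then obtain k where k: "\<And>n. map w [k n..<k n + length (V n)] = V n" by metis
  define s where "s n = D 0 (abelianization (seq_prefix w (k n)))" for n
  have "legal (seq_prefix w j)" for j using w unfolding rsubst_shift_iff seq_prefix_def by blast
  then have "s n \<in> cball 0 (2 * discrepancy_const)" for n using legal_discrepancy by (simp add: s_def)
  then obtain t r where r: "strict_mono r" "(s \<circ> r) \<longlonglongrightarrow> t"
    using compact_cball[of "0 :: real^'a" "2 * discrepancy_const"] unfolding compact_def by metis
  have "t + e \<in> seq_subtile L R w a" if e: "e \<in> digit_tile (\<lambda>_. \<Theta>) a" for e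
  proof -
    obtain p b where pb: "b 0 = a" "\<And>i. edge \<Theta> (p i) (b i) (b (Suc i))" "digit_sum p \<longlonglongrightarrow> e"
      using digit_tileD[of "\<lambda>_. \<Theta>", OF order_refl e] by blast
    define Q where "Q = {pf_projection L R (abelianization (seq_prefix w m)) |m. w m = a}"
    have "\<exists>x. norm (D 0 x) \<le> 2 * discrepancy_const \<and> s n + D n x + digit_sum p n \<in> Q" for n
    proof -
      obtain v q where v: "v \<in> level n [b n]" "prefix (q @ [b 0]) v" "D 0 (abelianization q) = digit_sum p n"
        using address_realization[of n p b] pb(2) by blast
      obtain y\<^sub>1 V\<^sub>1 where y1: "prefix y\<^sub>1 (y n)" "V\<^sub>1 \<in> level n y\<^sub>1" "prefix (V\<^sub>1 @ v) (V n)"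
        using yV(3)[OF v(1)] by blast
      have "prefix ((V\<^sub>1 @ q) @ [b 0]) (V n)" using v(2) y1(3) by (auto simp: prefix_def)
      from shift_prefix_append[OF k this]
      have at: "seq_prefix w (k n + length (V\<^sub>1 @ q)) = seq_prefix w (k n) @ V\<^sub>1 @ q"
        "w (k n + length (V\<^sub>1 @ q)) = a" using pb(1) by auto
      have "norm (D 0 (abelianization y\<^sub>1)) \<le> 2 * discrepancy_const"
        using legal_discrepancy legal_prefix[OF yV(1) y1(1)] by blast
      moreover have "s n + D n (abelianization y\<^sub>1) + digit_sum p n =
          pf_projection L R (abelianization (seq_prefix w (k n + length (V\<^sub>1 @ q))))"
        unfolding at(1) using D_level[OF y1(2), of 0] v(3)
        by (simp add: s_def abelianization_append D_add pf_projection_add flip: D_0)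
      ultimately show ?thesis unfolding Q_def using at(2) by blast
    qed
    then have "\<exists>x. \<forall>n. norm (D 0 (x n)) \<le> 2 * discrepancy_const \<and> s n + D n (x n) + digit_sum p n \<in> Q" by (intro choice allI)
    then obtain x where x: "\<And>n. norm (D 0 (x n)) \<le> 2 * discrepancy_const" "\<And>n. s n + D n (x n) + digit_sum p n \<in> Q"
      by blast
    have "(\<lambda>n. s (r n) + D (r n) (x (r n)) + digit_sum p (r n)) \<longlonglongrightarrow> t + 0 + e"
      using r(2) LIMSEQ_subseq_LIMSEQ[OF D_tendsto_zero[OF x(1)] r(1)] LIMSEQ_subseq_LIMSEQ[OF pb(3) r(1)]
      by (intro tendsto_add) (simp_all add: o_def)
    then show ?thesis
      unfolding seq_subtile_eq Q_def[symmetric] closure_sequential using x(2)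
      by (intro exI[of _ "\<lambda>n. s (r n) + D (r n) (x (r n)) + digit_sum p (r n)"]) simp
  qed
  then show ?thesis by blast
qed

text \<open>Otherwise the points \<open>n t + e\<close> leave every ball.\<close>
lemma translation_invariant_imp_zero:
  fixes E :: "(real^'a) set"
  assumes "e \<in> E" "\<And>x. x \<in> E \<Longrightarrow> t + x \<in> E" "\<And>x. x \<in> E \<Longrightarrow> norm x \<le> M"
  shows "t = 0"
proof (rule ccontr)
  assume t: "t \<noteq> 0"
  have mem: "real n *\<^sub>R t + e \<in> E" for n
  proof (induction n)
    case (Suc n)
    then show ?case using assms(2)[OF Suc] by (simp add: algebra_simps)
  qed (use assms(1) in simp)
  obtain n where n: "2 * M < real n * norm t" using reals_Archimedean3[of "norm t"] t by auto
  have "norm (real n *\<^sub>R t) \<le> norm (real n *\<^sub>R t + e) + norm e"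
    using norm_triangle_ineq4[of "real n *\<^sub>R t + e" e] by simp
  then show False using assms(3)[OF mem[of n]] assms(3)[OF assms(1)] n by simp
qed

text \<open>The translation obtained above is trivial, because it maps the bounded set of digit expansions
  into itself.\<close>
theorem dense_seq_subtile:
  assumes w: "w \<in> rsubst_shift_infinity (enveloping \<Theta>)"
    and dense: "dense_orbit_in w (rsubst_shift (enveloping \<Theta>))"
  shows "seq_subtile L R w a = digit_tile (\<lambda>_. \<Theta>) a"
proof
  show sub: "seq_subtile L R w a \<subseteq> digit_tile (\<lambda>_. \<Theta>) a"
  proof (rule seq_subtile_subset)
    fix n
    have "w \<in> (rsubst_seqs (enveloping \<Theta>) ^^ n) (rsubst_shift (enveloping \<Theta>))"
      using w by (simp add: rsubst_shift_infinity_def)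
    then show "\<exists>ws. ws 0 = w \<and> (\<forall>i<n. ws i \<in> rsubst_seq (enveloping \<Theta>) (ws (Suc i)))"
      by (rule rsubst_seqs_chain)
  qed simp
  show "digit_tile (\<lambda>_. \<Theta>) a \<subseteq> seq_subtile L R w a"
  proof
    fix e assume e: "e \<in> digit_tile (\<lambda>_. \<Theta>) a"
    obtain t where t: "\<And>e. e \<in> digit_tile (\<lambda>_. \<Theta>) a \<Longrightarrow> t + e \<in> seq_subtile L R w a"
      using translated_digit_tile_subset[OF shift_infinity_subset[OF w]] dense
      unfolding dense_orbit_iff_universal by blast
    have "t = 0"
      by (rule translation_invariant_imp_zero[OF e]) (use t sub bounded_digit_tile[of "\<lambda>_. \<Theta>"] in blast)+
    then show "e \<in> seq_subtile L R w a" using t[OF e] by simp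
  qed
qed

theorem rsubst_subtile_eq_digit_tile: "rsubst_subtile L R (enveloping \<Theta>) a = digit_tile (\<lambda>_. \<Theta>) a"
  unfolding rsubst_subtile_def
proof (rule the_equality)
  obtain w where w: "deep w" "\<forall>v. legal v \<longrightarrow> occurs v w" using universal_deep_sequence by blast
  then show "\<exists>w\<in>rsubst_shift_infinity (enveloping \<Theta>). dense_orbit_in w (rsubst_shift (enveloping \<Theta>)) \<and>
      digit_tile (\<lambda>_. \<Theta>) a = seq_subtile L R w a"
    using deep_in_shift_infinity dense_seq_subtile dense_orbit_iff_universal by metis
qed (use dense_seq_subtile in blast)

end

section \<open>The S-adic subtiles\<close>

lemma subst_word_append: "subst_word \<theta> (u @ v) = subst_word \<theta> u @ subst_word \<theta> v"
  by (simp add: subst_word_def)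

lemma foldr_subst_word_append:
  "foldr (\<lambda>i. subst_word (\<theta> i)) is (u @ v) =
   foldr (\<lambda>i. subst_word (\<theta> i)) is u @ foldr (\<lambda>i. subst_word (\<theta> i)) is v"
  by (induction "is") (simp_all add: subst_word_append)

lemma sadic_word_Suc: "sadic_word \<theta> (Suc n) u = sadic_word \<theta> n (subst_word (\<theta> (Suc n)) u)"
  by (simp add: sadic_word_def)

lemma sadic_word_shift: "sadic_word \<theta> (Suc n) u = subst_word (\<theta> 0) (sadic_word (\<lambda>i. \<theta> (Suc i)) n u)"
proof -
  have "[0..<Suc (Suc n)] = 0 # map Suc [0..<Suc n]"
    using upt_conv_Cons[of 0 "Suc (Suc n)"] map_Suc_upt[of 0 "Suc n"] by simp
  then show ?thesis by (simp add: sadic_word_def foldr_map o_def del: upt_Suc)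
qed

lemma adapted_shift: "adapted \<theta> \<alpha> \<Longrightarrow> adapted (\<lambda>i. \<theta> (Suc i)) (\<lambda>i. \<alpha> (Suc i))"
  by (simp add: adapted_def)

text \<open>For each \<open>n\<close> the condition can be satisfied below \<open>n\<close> by computing first letters downwards from
  an arbitrary letter; an infinite adapted sequence is a limit.\<close>
lemma adapted_exists: "\<exists>\<alpha>. adapted \<theta> (\<alpha> :: nat \<Rightarrow> 'a::finite)"
proof -
  define f where "f n i = foldr (\<lambda>j c. hd (\<theta> (Suc j) c)) [i..<n] undefined" for n i
  have f: "f n i = hd (\<theta> (Suc i) (f n (Suc i)))" if "i < n" for n i
    using that by (simp add: f_def upt_conv_Cons)
  obtain \<alpha> where \<alpha>: "\<And>N. \<exists>n\<ge>N. \<forall>i<N. f n i = \<alpha> i"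
    using finite_alphabet_limit[of "UNIV :: 'a set" f] by auto
  have "hd (\<theta> (Suc i) (\<alpha> (Suc i))) = \<alpha> i" for i
  proof -
    obtain n where n: "n \<ge> Suc (Suc i)" "\<forall>j<Suc (Suc i). f n j = \<alpha> j" using \<alpha> by blast
    then have "f n i = \<alpha> i" "f n (Suc i) = \<alpha> (Suc i)" by auto
    then show ?thesis using f[of i n] n(1) by simp
  qed
  then show ?thesis by (auto simp: adapted_def)
qed

context mixing_family
begin

lemma level_doubles: "v \<in> level \<kappa> u \<Longrightarrow> 2 * length u \<le> length v"
proof (induction u arbitrary: v)
  case (Cons c u)
  then obtain x y where "v = x @ y" "x \<in> level \<kappa> [c]" "y \<in> level \<kappa> u" by (auto simp: level_Cons[of \<kappa> c u])
  then show ?case using mixing[of x c c] Cons.IH[of y] by simp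
qed simp

lemma level_growth: "v \<in> level (s * \<kappa>) [b] \<Longrightarrow> 2 ^ s \<le> length v"
proof (induction s arbitrary: v)
  case (Suc s)
  then obtain u where "u \<in> level (s * \<kappa>) [b]" "v \<in> level \<kappa> u" by (auto simp: level_add)
  then show ?case using Suc.IH[of u] level_doubles[of v u] by simp
qed simp

lemma sadic_word_level: "(\<And>i. \<theta> i \<in> \<Theta>) \<Longrightarrow> sadic_word \<theta> n u \<in> level (Suc n) u"
  unfolding sadic_word_def using foldr_subst_word_level[of "[0..<Suc n]" \<theta> u] by simp

lemma sadic_word_nested:
  assumes "\<And>i. \<theta> i \<in> \<Theta>" "adapted \<theta> \<alpha>"
  shows "prefix (sadic_word \<theta> n [\<alpha> n]) (sadic_word \<theta> (Suc n) [\<alpha> (Suc n)])"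
proof -
  obtain r where "\<theta> (Suc n) (\<alpha> (Suc n)) = [\<alpha> n] @ r"
    using image_nonempty[OF assms(1), of "Suc n" "\<alpha> (Suc n)"] assms(2)
    unfolding adapted_def by (metis append_Cons append_Nil list.exhaust_sel)
  then have "sadic_word \<theta> (Suc n) [\<alpha> (Suc n)] = sadic_word \<theta> n ([\<alpha> n] @ r)"
    by (simp add: sadic_word_Suc subst_word_def)
  then show ?thesis unfolding sadic_word_def foldr_subst_word_append by simp
qed

lemma sadic_seq_unique:
  assumes "\<And>i. \<theta> i \<in> \<Theta>" "adapted \<theta> \<alpha>"
  shows "\<exists>!u. \<forall>n. seq_prefix u (length (sadic_word \<theta> n [\<alpha> n])) = sadic_word \<theta> n [\<alpha> n]"
proof (rule nested_words_limit)
  show "prefix (sadic_word \<theta> n [\<alpha> n]) (sadic_word \<theta> (Suc n) [\<alpha> (Suc n)])" for n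
    by (rule sadic_word_nested[OF assms])
  show "\<exists>n. N \<le> length (sadic_word \<theta> n [\<alpha> n])" for N
  proof -
    define n where "n = Suc N * \<kappa> - 1"
    have "Suc n = Suc N * \<kappa>" using mixing_exponent_pos by (simp add: n_def)
    then have "sadic_word \<theta> n [\<alpha> n] \<in> level (Suc N * \<kappa>) [\<alpha> n]"
      using sadic_word_level[of \<theta> n, OF assms(1)] by metis
    then have "2 ^ Suc N \<le> length (sadic_word \<theta> n [\<alpha> n])" by (rule level_growth)
    moreover have "N < 2 ^ Suc N" by (rule less_trans[OF less_exp]) simp
    ultimately show ?thesis by (intro exI[of _ n]) linarith
  qed
qed

lemma sadic_seq_prefix:
  assumes "\<And>i. \<theta> i \<in> \<Theta>" "adapted \<theta> \<alpha>"
  shows "seq_prefix (sadic_seq \<theta> \<alpha>) (length (sadic_word \<theta> n [\<alpha> n])) = sadic_word \<theta> n [\<alpha> n]"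
  using theI'[OF sadic_seq_unique[OF assms]] unfolding sadic_seq_def by blast

text \<open>Dropping the first substitution of the directive sequence desubstitutes the S-adic sequence.\<close>
lemma sadic_seq_desubstitute:
  assumes \<theta>: "\<And>i. \<theta> i \<in> \<Theta>" and \<alpha>: "adapted \<theta> \<alpha>"
  shows "sadic_seq \<theta> \<alpha> = seq_concat (\<lambda>j. \<theta> 0 (sadic_seq (\<lambda>i. \<theta> (Suc i)) (\<lambda>i. \<alpha> (Suc i)) j))"
    (is "_ = seq_concat ?v")
proof -
  let ?x = "sadic_seq (\<lambda>i. \<theta> (Suc i)) (\<lambda>i. \<alpha> (Suc i))"
  have Suc_case: "seq_prefix (seq_concat ?v) (length (sadic_word \<theta> (Suc n) [\<alpha> (Suc n)])) =
      sadic_word \<theta> (Suc n) [\<alpha> (Suc n)]" for n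
  proof -
    define W where "W = sadic_word (\<lambda>i. \<theta> (Suc i)) n [\<alpha> (Suc n)]"
    have W: "seq_prefix ?x (length W) = W"
      unfolding W_def by (rule sadic_seq_prefix[OF \<theta> adapted_shift[OF \<alpha>]])
    have "subst_word (\<theta> 0) (seq_prefix ?x l) = concat (map ?v [0..<l])" for l
      by (simp add: subst_word_def seq_prefix_def o_def)
    from this[of "length W"] have "subst_word (\<theta> 0) W = concat (map ?v [0..<length W])" by (simp only: W)
    then have W: "sadic_word \<theta> (Suc n) [\<alpha> (Suc n)] = concat (map ?v [0..<length W])"
      by (simp add: sadic_word_shift W_def)
    show ?thesis unfolding W by (rule seq_concat_prefix) (rule image_nonempty[OF \<theta>])
  qed
  have "seq_prefix (seq_concat ?v) (length (sadic_word \<theta> n [\<alpha> n])) = sadic_word \<theta> n [\<alpha> n]" for n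
    by (rule seq_prefix_of_prefix[OF Suc_case sadic_word_nested[OF assms]])
  then show ?thesis
    unfolding sadic_seq_def by (intro the1_equality sadic_seq_unique[OF assms]) blast
qed

end

context contracting_family
begin

text \<open>To realize an address of length \<open>n\<close>, its last letter \<open>b n\<close> is found in a prefix of the \<open>n\<close>-th
  desubstituted sequence that is an inflated letter of level \<open>\<kappa>\<close>; so the prefix in front of it has
  bounded discrepancy, and its contribution tends to zero.\<close>
theorem sadic_seq_subtile:
  assumes \<theta>: "\<And>i. \<theta> i \<in> \<Theta>" and \<alpha>: "adapted \<theta> \<alpha>"
  shows "seq_subtile L R (sadic_seq \<theta> \<alpha>) a = digit_tile (\<lambda>i. {\<theta> i}) a"
proof
  define U where "U n = sadic_seq (\<lambda>i. \<theta> (n + i)) (\<lambda>i. \<alpha> (n + i))" for n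
  have U0: "U 0 = sadic_seq \<theta> \<alpha>" by (simp add: U_def)
  have adapted: "adapted (\<lambda>i. \<theta> (n + i)) (\<lambda>i. \<alpha> (n + i))" for n using \<alpha> by (simp add: adapted_def)
  have U: "U n = seq_concat (\<lambda>j. \<theta> n (U (Suc n) j))" for n
    using sadic_seq_desubstitute[of "\<lambda>i. \<theta> (n + i)", OF \<theta> adapted[of n]] by (simp add: U_def)
  have T: "{\<theta> i} \<subseteq> \<Theta>" for i using \<theta> by simp
  show "seq_subtile L R (sadic_seq \<theta> \<alpha>) a \<subseteq> digit_tile (\<lambda>i. {\<theta> i}) a"
  proof (rule seq_subtile_subset[OF T])
    fix n
    have "U i \<in> rsubst_seq (enveloping {\<theta> i}) (U (Suc i))" for i
      by (subst U) (auto simp: rsubst_seq_def mem_enveloping)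
    then show "\<exists>ws. ws 0 = sadic_seq \<theta> \<alpha> \<and> (\<forall>i<n. ws i \<in> rsubst_seq (enveloping {\<theta> i}) (ws (Suc i)))"
      using U0 by blast
  qed
  show "digit_tile (\<lambda>i. {\<theta> i}) a \<subseteq> seq_subtile L R (sadic_seq \<theta> \<alpha>) a"
  proof
    fix e assume e: "e \<in> digit_tile (\<lambda>i. {\<theta> i}) a"
    obtain p b where pb: "b 0 = a" "\<And>i. edge {\<theta> i} (p i) (b i) (b (Suc i))" "digit_sum p \<longlonglongrightarrow> e"
      using digit_tileD[of "\<lambda>i. {\<theta> i}", OF T e] by blast
    have edges: "prefix (p i @ [b i]) (\<theta> i (b (Suc i)))" for i using pb(2)[of i] by (simp add: edge_def)
    define Q where "Q = {pf_projection L R (abelianization (seq_prefix (U 0) m)) |m. U 0 m = a}"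
    have "\<exists>x. norm (D 0 x) \<le> discrepancy_const \<and> digit_sum p n + D n x \<in> Q" for n
    proof -
      \<comment> \<open>\<open>sadic_word\<close> at index \<open>\<kappa> - 1\<close> composes \<open>\<kappa>\<close> substitutions.\<close>
      define v where "v = sadic_word (\<lambda>i. \<theta> (n + i)) (\<kappa> - 1) [\<alpha> (n + (\<kappa> - 1))]"
      have v: "v \<in> level \<kappa> [\<alpha> (n + (\<kappa> - 1))]"
        using sadic_word_level[of "\<lambda>i. \<theta> (n + i)" "\<kappa> - 1", OF \<theta>] mixing_exponent_pos by (simp add: v_def)
      then have "b n \<in> set v" using mixing by blast
      then obtain q r where q: "v = q @ b n # r" by (auto dest: split_list)
      have pre: "seq_prefix (U n) (length v) = v"
        unfolding U_def v_def by (rule sadic_seq_prefix[OF \<theta> adapted])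
      have qv: "prefix (q @ [b n]) v" using q by simp
      note at = seq_prefix_prefix_eq[OF pre qv]
      obtain m where m: "U 0 m = b 0"
        "D 0 (abelianization (seq_prefix (U 0) m)) = digit_sum p n + D n (abelianization (seq_prefix (U n) (length q)))"
        using address_position[of \<theta> n U p b "length q"] \<theta> U edges at(2) by blast
      have "digit_sum p n + D n (abelianization q) = pf_projection L R (abelianization (seq_prefix (U 0) m))"
        using m(2) by (simp add: D_0 at(1))
      then have "digit_sum p n + D n (abelianization q) \<in> Q" unfolding Q_def using m(1) pb(1) by blast
      moreover have "norm (D 0 (abelianization q)) \<le> discrepancy_const"
        by (rule bounded_discrepancy[OF v]) (use q in simp)
      ultimately show ?thesis by blast
    qed
    then have "\<exists>x. \<forall>n. norm (D 0 (x n)) \<le> discrepancy_const \<and> digit_sum p n + D n (x n) \<in> Q" by (intro choice allI)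
    then obtain x where x: "\<And>n. norm (D 0 (x n)) \<le> discrepancy_const" "\<And>n. digit_sum p n + D n (x n) \<in> Q" by blast
    have "(\<lambda>n. digit_sum p n + D n (x n)) \<longlonglongrightarrow> e + 0"
      by (rule tendsto_add[OF pb(3) D_tendsto_zero[OF x(1)]])
    then show "e \<in> seq_subtile L R (sadic_seq \<theta> \<alpha>) a"
      unfolding seq_subtile_eq U0[symmetric] Q_def[symmetric] closure_sequential using x(2)
      by (intro exI[of _ "\<lambda>n. digit_sum p n + D n (x n)"]) simp
  qed
qed

theorem sadic_subtile_eq_digit_tile:
  assumes \<theta>: "\<And>i. \<theta> i \<in> \<Theta>"
  shows "sadic_subtile L R \<theta> a = digit_tile (\<lambda>i. {\<theta> i}) a"
  unfolding sadic_subtile_def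
proof (rule the_equality)
  show "\<exists>\<alpha>. adapted \<theta> \<alpha> \<and> digit_tile (\<lambda>i. {\<theta> i}) a = seq_subtile L R (sadic_seq \<theta> \<alpha>) a"
  proof -
    obtain \<alpha> where \<alpha>: "adapted \<theta> \<alpha>" using adapted_exists by blast
    show ?thesis by (intro exI[of _ \<alpha>] conjI \<alpha> sadic_seq_subtile[OF \<theta> \<alpha>, symmetric])
  qed
next
  fix T assume "\<exists>\<alpha>. adapted \<theta> \<alpha> \<and> T = seq_subtile L R (sadic_seq \<theta> \<alpha>) a"
  then obtain \<alpha> where \<alpha>: "adapted \<theta> \<alpha>" and T: "T = seq_subtile L R (sadic_seq \<theta> \<alpha>) a" by (elim exE conjE)
  show "T = digit_tile (\<lambda>i. {\<theta> i}) a" unfolding T by (rule sadic_seq_subtile[OF \<theta> \<alpha>])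
qed

theorem Union_sadic_subtiles:
  "(\<Union>\<theta>\<in>(UNIV :: nat set) \<rightarrow> \<Theta>. sadic_subtile L R \<theta> a) = rsubst_subtile L R (enveloping \<Theta>) a"
proof -
  have "(\<Union>\<theta>\<in>(UNIV :: nat set) \<rightarrow> \<Theta>. digit_tile (\<lambda>i. {\<theta> i}) a) = digit_tile (\<lambda>_. \<Theta>) a"
  proof (intro equalityI subsetI)
    fix e assume "e \<in> (\<Union>\<theta>\<in>(UNIV :: nat set) \<rightarrow> \<Theta>. digit_tile (\<lambda>i. {\<theta> i}) a)"
    then obtain \<theta> where \<theta>: "\<theta> \<in> (UNIV :: nat set) \<rightarrow> \<Theta>" and e: "e \<in> digit_tile (\<lambda>i. {\<theta> i}) a"
      by (rule UN_E)
    have T: "{\<theta> i} \<subseteq> \<Theta>" for i using \<theta> by auto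
    obtain p b where pb: "e = (\<Sum>i. D i (abelianization (p i)))" "b 0 = a"
      "\<And>i. edge {\<theta> i} (p i) (b i) (b (Suc i))" using e unfolding digit_tile_def by blast
    have "edge \<Theta> (p i) (b i) (b (Suc i))" for i using pb(3)[of i] T[of i] by (auto simp: edge_def)
    then show "e \<in> digit_tile (\<lambda>_. \<Theta>) a" unfolding digit_tile_def using pb(1,2) by blast
  next
    fix e assume "e \<in> digit_tile (\<lambda>_. \<Theta>) a"
    then obtain p b where pb: "e = (\<Sum>i. D i (abelianization (p i)))" "b 0 = a"
      "\<And>i. edge \<Theta> (p i) (b i) (b (Suc i))" unfolding digit_tile_def by blast
    have "\<forall>i. \<exists>\<theta>. \<theta> \<in> \<Theta> \<and> prefix (p i @ [b i]) (\<theta> (b (Suc i)))" using pb(3) unfolding edge_def by blast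
    then have "\<exists>\<theta>. \<forall>i. \<theta> i \<in> \<Theta> \<and> prefix (p i @ [b i]) (\<theta> i (b (Suc i)))" by (rule choice)
    then obtain \<theta> where \<theta>: "\<And>i. \<theta> i \<in> \<Theta>" "\<And>i. prefix (p i @ [b i]) (\<theta> i (b (Suc i)))" by blast
    have "\<forall>i. edge {\<theta> i} (p i) (b i) (b (Suc i))" using \<theta>(2) by (simp add: edge_def)
    then have "e \<in> digit_tile (\<lambda>i. {\<theta> i}) a" unfolding digit_tile_def using pb by blast
    moreover have "\<theta> \<in> UNIV \<rightarrow> \<Theta>" using \<theta>(1) by simp
    ultimately show "e \<in> (\<Union>\<theta>\<in>(UNIV :: nat set) \<rightarrow> \<Theta>. digit_tile (\<lambda>i. {\<theta> i}) a)" by blast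
  qed
  moreover have "sadic_subtile L R \<theta> a = digit_tile (\<lambda>i. {\<theta> i}) a" if "\<theta> \<in> UNIV \<rightarrow> \<Theta>" for \<theta>
    using that by (intro sadic_subtile_eq_digit_tile) auto
  ultimately show ?thesis by (simp add: rsubst_subtile_eq_digit_tile)
qed

end

section \<open>Integer matrices with irreducible characteristic polynomial\<close>

abbreviation int_poly_eval :: "int poly \<Rightarrow> 'b::comm_ring_1 \<Rightarrow> 'b" where
  "int_poly_eval q \<equiv> poly (map_poly of_int q)"

lemma int_poly_eval_pCons: "int_poly_eval (pCons c q) z = of_int c + z * int_poly_eval q z"
  by (cases "q = 0 \<and> c = 0") (auto simp: map_poly_pCons)

lemma int_poly_eval_add:
  fixes z :: "'b::comm_ring_1"
  shows "int_poly_eval (p + q) z = int_poly_eval p z + int_poly_eval q z"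
proof -
  have "map_poly of_int (p + q) = map_poly of_int p + (map_poly of_int q :: 'b poly)"
    by (rule poly_eqI) (simp add: coeff_map_poly)
  then show ?thesis by simp
qed

lemma int_poly_eval_mult: "int_poly_eval (p * q) z = int_poly_eval p z * int_poly_eval q z"
proof (induction p)
  case (pCons c p)
  have sm: "int_poly_eval (smult c q) z = of_int c * int_poly_eval q z"
    by (simp add: map_poly_smult)
  show ?case
    using pCons.IH by (simp add: int_poly_eval_pCons int_poly_eval_add sm algebra_simps)
qed simp

text \<open>Up to a constant factor \<open>p\<close> is the minimal polynomial of \<open>z\<close>. The proof stays within integer
  polynomials: a polynomial \<open>m\<close> of least degree with root \<open>z\<close> divides, by pseudo-division, a
  constant multiple of every polynomial with root \<open>z\<close>, in particular of \<open>p\<close>; and as \<open>p\<close> is prime,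
  it divides \<open>m\<close>, and then, again by primality, every polynomial with root \<open>z\<close>.\<close>
lemma irreducible_int_poly_dvd:
  fixes p f :: "int poly" and z :: "'b::{idom,ring_char_0}"
  assumes irr: "irreducible p" and pz: "int_poly_eval p z = 0" and fz: "int_poly_eval f z = 0"
  shows "p dvd f"
proof -
  define Z where "Z q \<longleftrightarrow> q \<noteq> 0 \<and> int_poly_eval q z = 0" for q :: "int poly"
  have p0: "p \<noteq> 0" using irr by auto
  then have "Z p" using pz by (simp add: Z_def)
  then obtain m where m: "Z m" "\<And>q. Z q \<Longrightarrow> degree m \<le> degree q"
    using ex_has_least_nat[of Z p degree] by blast
  have deg: "degree q > 0" if "Z q" for q
  proof (rule ccontr)
    assume "\<not> degree q > 0"
    then obtain c where "q = [:c:]" by (metis degree_eq_zeroE gr0I)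
    with that show False by (simp add: Z_def int_poly_eval_pCons)
  qed
  have multiple: "\<exists>c q. c \<noteq> 0 \<and> smult c g = m * q" if "int_poly_eval g z = 0" for g
  proof -
    obtain q r where qr: "pseudo_divmod g m = (q, r)" by force
    define c where "c = coeff m (degree m) ^ (Suc (degree g) - degree m)"
    have m0: "m \<noteq> 0" using m(1) by (simp add: Z_def)
    have eq: "smult c g = m * q + r" unfolding c_def by (rule pseudo_divmod(1)[OF m0 qr])
    have "int_poly_eval ([:c:] * g) z = 0" by (simp only: int_poly_eval_mult that) simp
    then have "int_poly_eval r z = 0"
      using eq m(1) by (simp add: int_poly_eval_add int_poly_eval_mult Z_def)
    then have "r = 0"
      using pseudo_divmod(2)[OF m0 qr] m(2)[of r] unfolding Z_def by linarith
    moreover have "c \<noteq> 0" using m0 by (simp add: c_def)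
    ultimately show ?thesis using eq by auto
  qed
  have prime: "prime_elem p" using irr by (rule irreducible_imp_prime_elem)
  have dvd_of_smult: "p dvd g" if "p dvd smult c g" "c \<noteq> 0" for c g
  proof -
    have "p dvd [:c:] * g" using that by simp
    moreover have "\<not> p dvd [:c:]"
      using deg[OF \<open>Z p\<close>] dvd_imp_degree_le[of p "[:c:]"] that(2) by auto
    ultimately show ?thesis using prime prime_elem_dvd_mult_iff by blast
  qed
  obtain c q where cq: "c \<noteq> 0" "smult c p = m * q" using multiple[OF pz] by auto
  have "\<not> p dvd q"
  proof
    assume "p dvd q"
    then obtain s where "q = p * s" by auto
    then have "p * [:c:] = p * (m * s)" using cq by (simp add: algebra_simps)
    then have ms: "[:c:] = m * s" using p0 by (simp only: mult_cancel_left) simp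
    then have "s \<noteq> 0" using cq(1) by auto
    then have "degree (m * s) > 0"
      using deg[OF m(1)] m(1) by (simp add: degree_mult_eq Z_def)
    then show False by (simp flip: ms)
  qed
  moreover have "p dvd m * q" unfolding cq(2)[symmetric] by (rule dvd_smult) simp
  ultimately have pm: "p dvd m" using prime prime_elem_dvd_mult_iff by blast
  obtain d s where ds: "d \<noteq> 0" "smult d f = m * s" using multiple[OF fz] by auto
  then have "p dvd smult d f" using pm by (simp add: dvd_mult2)
  then show ?thesis using dvd_of_smult ds(1) by blast
qed

lemma independent_eigenvectors:
  fixes B :: "'k::field^'a^'a::finite"
  assumes "finite S" "\<And>z. z \<in> S \<Longrightarrow> B *v v z = z *s v z" "\<And>z. z \<in> S \<Longrightarrow> v z \<noteq> 0"
    "(\<Sum>z\<in>S. c z *s v z) = 0"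
  shows "\<forall>z\<in>S. c z = 0"
  using assms
proof (induction S arbitrary: c)
  case (insert w S)
  have eq: "c w *s v w + (\<Sum>z\<in>S. c z *s v z) = 0"
    using insert by simp
  have "B *v (c w *s v w + (\<Sum>z\<in>S. c z *s v z)) = 0"
    by (simp only: eq matrix_vector_mult_0_right)
  then have "(c w * w) *s v w + (\<Sum>z\<in>S. (c z * z) *s v z) = 0"
    using insert.prems by (simp add: vec.add vec.sum vec.scale vec.scale_scale cong: sum.cong)
  moreover have "w *s (c w *s v w + (\<Sum>z\<in>S. c z *s v z)) = 0"
    by (simp only: eq) simp
  ultimately have "(\<Sum>z\<in>S. (c z * z) *s v z) = w *s (\<Sum>z\<in>S. c z *s v z)"
    by (simp add: eq_neg_iff_add_eq_0[symmetric] vec.scale_right_distrib mult.commute)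
  moreover have "(\<Sum>z\<in>S. (c z * (z - w)) *s v z) =
      (\<Sum>z\<in>S. (c z * z) *s v z) - w *s (\<Sum>z\<in>S. c z *s v z)"
    unfolding vec.scale_sum_right sum_subtractf[symmetric]
    by (intro sum.cong refl) (simp add: vec_eq_iff algebra_simps)
  ultimately have "(\<Sum>z\<in>S. (c z * (z - w)) *s v z) = 0" by simp
  then have "\<forall>z\<in>S. c z * (z - w) = 0"
    using insert by (intro insert.IH) auto
  then have c0: "\<forall>z\<in>S. c z = 0"
    using insert.hyps by auto
  then have "c w *s v w = 0" using eq by simp
  then have "c w = 0" using insert.prems(2)[of w] by simp
  with c0 show ?case by simp
qed simp

text \<open>The ring homomorphism is given by its equations, so that polynomial evaluation qualifies.\<close>
lemma det_of_ring_hom: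
  fixes h :: "'x::comm_ring_1 \<Rightarrow> 'y::comm_ring_1"
  assumes "\<And>x y. h (x + y) = h x + h y" "\<And>x y. h (x * y) = h x * h y" "h 1 = 1"
  shows "h (det X) = det (map_matrix h X)"
proof -
  have h0: "h 0 = 0" using assms(1)[of 0 0] by simp
  have neg: "h (- x) = - h x" for x using assms(1)[of x "-x"] h0 by (simp add: eq_neg_iff_add_eq_0 add.commute)
  have sm: "h (sum f S) = (\<Sum>x\<in>S. h (f x))" for f :: "('c \<Rightarrow> 'c) \<Rightarrow> 'x" and S
    by (induction S rule: infinite_finite_induct) (auto simp: h0 assms)
  have pr: "h (prod f S) = (\<Prod>x\<in>S. h (f x))" for f :: "'c \<Rightarrow> 'x" and S
    by (induction S rule: infinite_finite_induct) (auto simp: assms)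
  have sg: "h (of_int (sign p)) = of_int (sign p)" for p :: "'c \<Rightarrow> 'c"
    by (auto simp: sign_def assms neg)
  show ?thesis
    unfolding det_def by (simp add: sm pr sg assms map_matrix_def)
qed

lemma poly_char_polynomial:
  fixes M :: "int^'a^'a::finite" and z :: complex
  shows "poly (map_poly of_int (char_polynomial M)) z = det (mat z - map_matrix complex_of_int M)"
proof -
  define h where "h q = poly (map_poly complex_of_int q) z" for q :: "int poly"
  have "h (det (mat [:0, 1:] - map_matrix (\<lambda>c. [:c:]) M)) = det (map_matrix h (mat [:0, 1:] - map_matrix (\<lambda>c. [:c:]) M))"
    by (rule det_of_ring_hom) (auto simp: h_def  int_poly_eval_mult int_poly_eval_add)
  also have "map_matrix h (mat [:0, 1:] - map_matrix (\<lambda>c. [:c:]) M) = mat z - map_matrix complex_of_int M"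
    by (simp add: vec_eq_iff map_matrix_def mat_def h_def int_poly_eval_pCons)
  finally show ?thesis by (simp add: h_def char_polynomial_def)
qed

lemma eigenvalue_iff_root:
  fixes M :: "int^'a^'a::finite" and z :: complex
  shows "is_eigenvalue (map_matrix complex_of_int M) z \<longleftrightarrow> poly (map_poly of_int (char_polynomial M)) z = 0"
proof -
  let ?B = "map_matrix complex_of_int M"
  have "det (mat z - ?B) = 0 \<longleftrightarrow> (\<exists>v. v \<noteq> 0 \<and> (mat z - ?B) *v v = 0)"
    using invertible_det_nz[of "mat z - ?B"] matrix_left_invertible_ker[of "mat z - ?B"]
    by (auto simp: invertible_left_inverse)
  also have "\<dots> \<longleftrightarrow> is_eigenvalue ?B z"
  proof -
    have "mat z *v v = z *s v" for v :: "complex^'a"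
      by (simp add: vec_eq_iff matrix_vector_mult_def mat_def if_distrib[of "\<lambda>x. x * _"] cong: if_cong)
    then show ?thesis unfolding is_eigenvalue_def by (simp add: matrix_vector_mult_diff_rdistrib) metis
  qed
  finally show ?thesis by (simp add: poly_char_polynomial)
qed

text \<open>In the Leibniz formula only the identity permutation picks the variable from every row.\<close>
lemma degree_char_polynomial: "degree (char_polynomial (M :: int^'a^'a::finite)) = CARD('a)"
proof -
  define X where "X = mat [:0, 1:] - map_matrix (\<lambda>c. [:c:]) M"
  have Xij: "X $ i $ j = (if i = j then [:- (M$i$i), 1:] else [:- (M$i$j):])" for i j
    by (auto simp: X_def mat_def map_matrix_def)
  let ?U = "UNIV :: 'a set"
  let ?P = "{p. p permutes ?U}"
  let ?t = "\<lambda>p. of_int (sign p) * (\<Prod>i\<in>?U. X $ i $ p i)"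
  have fin: "finite ?P" by (simp add: finite_permutations)
  have dt: "det X = ?t id + (\<Sum>p\<in>?P - {id}. ?t p)"
    unfolding det_def using fin by (subst sum.remove[of _ id]) (auto simp: permutes_id)
  have d0: "degree (?t id) = CARD('a)"
    by (simp add: Xij sign_id degree_prod_eq_sum_degree)
  have "degree (?t p) < CARD('a)" if "p \<in> ?P - {id}" for p
  proof -
    have "p \<noteq> id" using that by simp
    then obtain i where i: "p i \<noteq> i" by (metis eq_id_iff)
    have "degree (?t p) \<le> degree (\<Prod>i\<in>?U. X $ i $ p i)"
      by (auto simp: sign_def)
    also have "\<dots> \<le> (\<Sum>i\<in>?U. degree (X $ i $ p i))"
      by (rule degree_prod_sum_le[unfolded o_def]) simp
    also have "\<dots> < (\<Sum>i\<in>?U. 1)"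
      by (rule sum_strict_mono_ex1) (auto simp: Xij intro!: exI[of _ i] i[symmetric])
    finally show ?thesis by simp
  qed
  then have "degree (\<Sum>p\<in>?P - {id}. ?t p) < CARD('a)"
    using fin by (intro degree_sum_less) auto
  then have "degree (det X) = CARD('a)"
    unfolding dt by (subst degree_add_eq_left) (simp_all only: d0)
  then show ?thesis by (simp add: char_polynomial_def X_def)
qed

text \<open>A double root would make the characteristic polynomial divide its nonzero derivative.\<close>
lemma char_polynomial_rsquarefree:
  fixes M :: "int^'a^'a::finite"
  assumes "irreducible (char_polynomial M)"
  shows "rsquarefree (map_poly complex_of_int (char_polynomial M))"
  unfolding rsquarefree_roots
proof (intro allI notI, elim conjE)
  let ?p = "char_polynomial M"
  fix z assume z: "int_poly_eval ?p z = 0" "poly (pderiv (map_poly complex_of_int ?p)) z = 0"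
  have "pderiv (map_poly complex_of_int ?p) = map_poly of_int (pderiv ?p)"
    by (rule poly_eqI) (simp add: coeff_map_poly coeff_pderiv)
  with z have "?p dvd pderiv ?p"
    by (intro irreducible_int_poly_dvd[OF assms, of z]) auto
  moreover have "pderiv ?p \<noteq> 0"
    by (simp add: pderiv_eq_0_iff degree_char_polynomial)
  ultimately have "degree ?p \<le> degree (pderiv ?p)" by (intro dvd_imp_degree_le)
  then show False using zero_less_card_finite[where ?'a = 'a] by (simp add: degree_pderiv degree_char_polynomial del: zero_less_card_finite)
qed

lemma card_eigenvalues:
  fixes M :: "int^'a^'a::finite"
  assumes "irreducible (char_polynomial M)"
  defines "S \<equiv> {z. is_eigenvalue (map_matrix complex_of_int M) z}"
  shows "finite S" "card S = CARD('a)"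
proof -
  let ?p = "map_poly complex_of_int (char_polynomial M)"
  have deg: "degree ?p = CARD('a)" by (simp add: degree_map_poly degree_char_polynomial)
  then have p0: "?p \<noteq> 0" by auto
  have S: "S = {z. poly ?p z = 0}" by (simp add: S_def eigenvalue_iff_root)
  show "finite S" unfolding S by (rule poly_roots_finite[OF p0])
  have "degree ?p = degree (smult (lead_coeff ?p) (\<Prod>z\<in>S. [:- z, 1:]))"
    unfolding S using complex_poly_decompose_rsquarefree[OF char_polynomial_rsquarefree[OF assms(1)]] by simp
  also have "\<dots> = card S" using p0 by (simp add: degree_prod_eq_sum_degree)
  finally show "card S = CARD('a)" using deg by simp
qed

text \<open>There are as many distinct eigenvalues as the dimension, so one eigenvector for each of them
  gives a basis.\<close>
lemma eigenbasis:
  fixes M :: "int^'a^'a::finite"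
  assumes "irreducible (char_polynomial M)"
  defines "B \<equiv> map_matrix complex_of_int M"
  defines "S \<equiv> {z. is_eigenvalue B z}"
  obtains v where "\<And>z. z \<in> S \<Longrightarrow> B *v v z = z *s v z" "\<And>x. \<exists>c. x = (\<Sum>z\<in>S. c z *s v z)"
proof -
  note S = card_eigenvalues[OF assms(1), folded B_def, folded S_def]
  have "\<forall>z\<in>S. \<exists>v. v \<noteq> 0 \<and> B *v v = z *s v" by (simp add: S_def is_eigenvalue_def)
  then obtain v where v: "\<And>z. z \<in> S \<Longrightarrow> v z \<noteq> 0" "\<And>z. z \<in> S \<Longrightarrow> B *v v z = z *s v z"
    by metis
  have inj: "inj_on v S"
    by (rule inj_onI) (metis v vec.scale_right_imp_eq)
  have "vec.independent (v ` S)"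
    unfolding vec.dependent_finite[OF finite_imageI[OF S(1)]]
  proof safe
    fix u z assume "(\<Sum>w\<in>v ` S. u w *s w) = 0" and z: "z \<in> S" "u (v z) \<noteq> 0"
    then have "(\<Sum>z\<in>S. u (v z) *s v z) = 0" by (simp add: sum.reindex[OF inj])
    from independent_eigenvectors[OF S(1) v(2) v(1) this] z show False by blast
  qed
  then have "UNIV \<subseteq> vec.span (v ` S)"
    by (intro vec.card_ge_dim_independent) (auto simp: card_image[OF inj] S(2) card_cart_basis)
  then have "\<exists>c. x = (\<Sum>z\<in>S. c z *s v z)" for x
    by (force simp: vec.span_finite[OF finite_imageI[OF S(1)]] sum.reindex[OF inj])
  then show ?thesis using that v(2) by blast
qed

text \<open>The characteristic polynomial divides the polynomial that witnesses the Pisot property, so all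
  eigenvalues are conjugates of \<open>l\<close>.\<close>
lemma pisot_other_eigenvalues:
  fixes M :: "int^'a^'a::finite"
  assumes "irreducible (char_polynomial M)" "pisot_number l"
    "is_eigenvalue (map_matrix complex_of_int M) (of_real l)"
    "is_eigenvalue (map_matrix complex_of_int M) z" "z \<noteq> of_real l"
  shows "cmod z < 1"
proof -
  obtain q :: "int poly" where q: "irreducible q" "int_poly_eval q l = 0"
    "\<And>z. int_poly_eval q z = 0 \<Longrightarrow> z \<noteq> of_real l \<Longrightarrow> cmod z < 1"
    using assms(2) unfolding pisot_number_def by auto
  have "int_poly_eval q (complex_of_real l) = of_real (int_poly_eval q l)"
    by (induction q) (auto simp: int_poly_eval_pCons)
  then have "char_polynomial M dvd q"
    using q(2) assms(3) by (intro irreducible_int_poly_dvd[OF assms(1), of "of_real l :: complex"])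
      (auto simp: eigenvalue_iff_root)
  then obtain s where "q = char_polynomial M * s" by auto
  then have "int_poly_eval q z = 0"
    using assms(4) by (simp add: int_poly_eval_mult eigenvalue_iff_root)
  then show ?thesis using q(3) assms(5) by blast
qed

section \<open>Contraction on the hyperplane orthogonal to the left eigenvector\<close>

definition cvec :: "real^'a \<Rightarrow> complex^'a" where
  "cvec x = (\<chi> i. complex_of_real (x $ i))"

lemma cvec_funpow:
  fixes M :: "int^'a^'a::finite"
  shows "cvec (((*v) (map_matrix real_of_int M) ^^ n) x) = ((*v) (map_matrix complex_of_int M) ^^ n) (cvec x)"
proof (induction n)
  case (Suc n)
  have "cvec (map_matrix real_of_int M *v y) = map_matrix complex_of_int M *v cvec y" for y
    by (simp add: cvec_def vec_eq_iff matrix_vector_mult_def map_matrix_def)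
  with Suc show ?case by simp
qed simp

lemma eigenvalue_complexification:
  fixes M :: "int^'a^'a::finite"
  assumes "is_eigenvalue (map_matrix real_of_int M) l"
  shows "is_eigenvalue (map_matrix complex_of_int M) (of_real l)"
proof -
  obtain v where v: "v \<noteq> 0" "map_matrix real_of_int M *v v = l *s v"
    using assms by (auto simp: is_eigenvalue_def)
  have "cvec (map_matrix real_of_int M *v v) = map_matrix complex_of_int M *v cvec v"
    using cvec_funpow[where M = M and n = 1 and x = v] by simp
  moreover have "cvec (l *s v) = of_real l *s cvec v" by (simp add: cvec_def vec_eq_iff)
  moreover have "cvec v \<noteq> 0" using v(1) by (auto simp: cvec_def vec_eq_iff)
  ultimately show ?thesis using v(2) unfolding is_eigenvalue_def by metis
qed

text \<open>Each of the two is an eigenvalue, hence bounded by the other.\<close>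
lemma pf_eigenvalue_unique:
  fixes M :: "int^'a^'a::finite"
  assumes "pf_eigenvalue M l" "pf_eigenvalue M l'"
  shows "l = l'"
proof -
  have "cmod (of_real l) \<le> l'" "cmod (of_real l') \<le> l"
    using assms eigenvalue_complexification unfolding pf_eigenvalue_def by blast+
  then show ?thesis by simp
qed

lemma funpow_eigen_sum:
  fixes B :: "complex^'a^'a::finite"
  assumes "finite S" "\<And>z. z \<in> S \<Longrightarrow> B *v v z = z *s v z"
  shows "((*v) B ^^ n) (\<Sum>z\<in>S. c z *s v z) = (\<Sum>z\<in>S. (c z * z ^ n) *s v z)"
proof (induction n)
  case (Suc n)
  have "((*v) B ^^ Suc n) (\<Sum>z\<in>S. c z *s v z) = (\<Sum>z\<in>S. (c z * z ^ n) *s (B *v v z))"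
    by (simp add: Suc.IH vec.sum vec.scale)
  also have "\<dots> = (\<Sum>z\<in>S. (c z * z ^ Suc n) *s v z)"
    by (intro sum.cong refl) (simp add: assms(2) vec_eq_iff mult_ac)
  finally show ?case .
qed simp

text \<open>Bilinear rather than sesquilinear, so that it is complex linear in \<open>u\<close>.\<close>
definition pairing :: "real^'a \<Rightarrow> complex^'a::finite \<Rightarrow> complex" where
  "pairing L u = (\<Sum>i\<in>UNIV. of_real (L $ i) * u $ i)"

lemma pairing_sum: "pairing L (\<Sum>z\<in>S. c z *s v z) = (\<Sum>z\<in>S. c z * pairing L (v z))"
  unfolding pairing_def sum_distrib_left by (subst sum.swap) (simp add: sum_distrib_left mult_ac)

lemma pairing_scale: "pairing L (c *s u) = c * pairing L u"
  by (simp add: pairing_def sum_distrib_left mult_ac)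

lemma pairing_cvec: "pairing L (cvec x) = of_real (L \<bullet> x)"
  by (simp add: pairing_def cvec_def inner_vec_def)

lemma pairing_matrix:
  fixes M :: "int^'a^'a::finite"
  assumes "L v* map_matrix real_of_int M = l *\<^sub>R L"
  shows "pairing L (map_matrix complex_of_int M *v u) = of_real l * pairing L u"
proof -
  have col: "(\<Sum>i\<in>UNIV. of_real (L $ i) * complex_of_int (M $ i $ j)) = of_real (l * L $ j)" for j
  proof -
    have "(\<Sum>i\<in>UNIV. L $ i * real_of_int (M $ i $ j)) = l * L $ j"
      using arg_cong[OF assms, of "\<lambda>x. x $ j"]
      by (simp add: vector_matrix_mult_def map_matrix_def mult.commute)
    then show ?thesis by (simp flip: \<open>_ = l * L $ j\<close>)
  qed
  have "pairing L (map_matrix complex_of_int M *v u) =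
      (\<Sum>i\<in>UNIV. \<Sum>j\<in>UNIV. of_real (L $ i) * complex_of_int (M $ i $ j) * u $ j)"
    by (simp add: pairing_def matrix_vector_mult_def map_matrix_def sum_distrib_left mult.assoc)
  also have "\<dots> = (\<Sum>j\<in>UNIV. (\<Sum>i\<in>UNIV. of_real (L $ i) * complex_of_int (M $ i $ j)) * u $ j)"
    by (subst sum.swap) (simp add: sum_distrib_right)
  also have "\<dots> = of_real l * pairing L u"
    by (simp add: col pairing_def sum_distrib_left mult.assoc)
  finally show ?thesis .
qed

text \<open>A left eigenvector for \<open>l\<close> annihilates the eigenvectors of all other eigenvalues. It does not
  vanish on the whole basis, so it does not vanish on the eigenvector for \<open>l\<close>; hence
  vectors orthogonal to it have no component in that direction.\<close>
lemma hyperplane_expansion: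
  fixes M :: "int^'a^'a::finite"
  assumes irr: "irreducible (char_polynomial M)"
    and L: "L \<noteq> 0" "L v* map_matrix real_of_int M = l *\<^sub>R L"
  defines "S \<equiv> {z. is_eigenvalue (map_matrix complex_of_int M) z}"
  obtains v where "\<And>z. z \<in> S \<Longrightarrow> map_matrix complex_of_int M *v v z = z *s v z"
    "\<And>x. L \<bullet> x = 0 \<Longrightarrow> \<exists>c. cvec x = (\<Sum>z\<in>S - {of_real l}. c z *s v z)"
proof -
  let ?B = "map_matrix complex_of_int M"
  have finS: "finite S" unfolding S_def by (rule card_eigenvalues(1)[OF irr])
  obtain v where v: "\<And>z. z \<in> S \<Longrightarrow> ?B *v v z = z *s v z" "\<And>x. \<exists>c. x = (\<Sum>z\<in>S. c z *s v z)"
    using eigenbasis[OF irr] unfolding S_def by blast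
  have zero: "pairing L (v z) = 0" if "z \<in> S" "z \<noteq> of_real l" for z
  proof -
    have "z * pairing L (v z) = of_real l * pairing L (v z)"
      using pairing_matrix[OF L(2), of "v z"] v(1)[OF that(1)] by (simp add: pairing_scale)
    then show ?thesis using that(2) by simp
  qed
  have expand: "pairing L (\<Sum>z\<in>S. c z *s v z) =
      (if of_real l \<in> S then c (of_real l) * pairing L (v (of_real l)) else 0)" for c
  proof -
    have "(\<Sum>z\<in>S. c z * pairing L (v z)) = (\<Sum>z\<in>S. if z = of_real l then c z * pairing L (v z) else 0)"
      by (intro sum.cong refl) (simp add: zero)
    then show ?thesis by (simp add: pairing_sum sum.delta[OF finS])
  qed
  obtain i where i: "L $ i \<noteq> 0" using L(1) by (auto simp: vec_eq_iff)
  have nz: "of_real l \<in> S \<and> pairing L (v (of_real l)) \<noteq> 0"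
  proof -
    obtain c where c: "cvec (axis i 1) = (\<Sum>z\<in>S. c z *s v z)" using v(2) by blast
    have "pairing L (cvec (axis i 1)) \<noteq> 0" using i by (simp add: pairing_cvec inner_axis)
    then show ?thesis unfolding c expand by (simp split: if_splits)
  qed
  have "\<exists>c. cvec x = (\<Sum>z\<in>S - {of_real l}. c z *s v z)" if "L \<bullet> x = 0" for x
  proof -
    obtain c where c: "cvec x = (\<Sum>z\<in>S. c z *s v z)" using v(2) by blast
    have "pairing L (cvec x) = 0" using that by (simp add: pairing_cvec)
    then have "c (of_real l) = 0" using nz unfolding c expand by simp
    then have "cvec x = (\<Sum>z\<in>S - {of_real l}. c z *s v z)"
      unfolding c using nz finS by (simp add: sum.remove[of S "of_real l"])
    then show ?thesis by blast
  qed
  with v(1) that show thesis by blast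
qed

lemma contraction_on_hyperplane:
  fixes M :: "int^'a^'a::finite"
  assumes irr: "irreducible (char_polynomial M)"
    and L: "L \<noteq> 0" "L v* map_matrix real_of_int M = l *\<^sub>R L"
    and small: "\<And>z. is_eigenvalue (map_matrix complex_of_int M) z \<Longrightarrow> z \<noteq> of_real l \<Longrightarrow> cmod z < 1"
  shows "\<exists>\<rho>. 0 < \<rho> \<and> \<rho> < 1 \<and>
    (\<forall>x. L \<bullet> x = 0 \<longrightarrow> (\<exists>C. \<forall>n. norm (((*v) (map_matrix real_of_int M) ^^ n) x) \<le> C * \<rho> ^ n))"
proof -
  let ?A = "map_matrix real_of_int M" and ?B = "map_matrix complex_of_int M"
  define S where "S = {z. is_eigenvalue ?B z} - {of_real l}"
  have finS: "finite S" using card_eigenvalues(1)[OF irr] by (simp add: S_def)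
  obtain v where v: "\<And>z. z \<in> {z. is_eigenvalue ?B z} \<Longrightarrow> ?B *v v z = z *s v z"
    "\<And>x. L \<bullet> x = 0 \<Longrightarrow> \<exists>c. cvec x = (\<Sum>z\<in>S. c z *s v z)"
    using hyperplane_expansion[OF irr L] unfolding S_def by blast
  have vS: "?B *v v z = z *s v z" if "z \<in> S" for z using v(1)[of z] that by (simp add: S_def)
  define \<rho> where "\<rho> = Max (insert (1/2) (cmod ` S))"
  have fin: "finite (insert (1/2) (cmod ` S))" using finS by simp
  have rate: "0 < \<rho>"
    using Max_ge[OF fin, of "1/2"] by (simp add: \<rho>_def)
  have rate1: "\<rho> < 1"
    unfolding \<rho>_def using fin by (subst Max_less_iff) (auto simp: S_def intro: small)
  have le: "cmod z \<le> \<rho>" if "z \<in> S" for z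
    unfolding \<rho>_def using that by (intro Max_ge[OF fin]) simp
  have "\<exists>C. \<forall>n. norm (((*v) ?A ^^ n) x) \<le> C * \<rho> ^ n" if x: "L \<bullet> x = 0" for x
  proof -
    obtain c where c: "cvec x = (\<Sum>z\<in>S. c z *s v z)" using v(2)[OF x] by blast
    define C where "C i = (\<Sum>z\<in>S. cmod (c z) * cmod (v z $ i))" for i
    have "norm (((*v) ?A ^^ n) x) \<le> (\<Sum>i\<in>UNIV. C i) * \<rho> ^ n" for n
    proof -
      let ?y = "((*v) ?A ^^ n) x"
      have "\<bar>?y $ i\<bar> \<le> C i * \<rho> ^ n" for i
      proof -
        have "cvec ?y = (\<Sum>z\<in>S. (c z * z ^ n) *s v z)"
          unfolding cvec_funpow c by (rule funpow_eigen_sum[OF finS vS])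
        from arg_cong[OF this, of "\<lambda>u. cmod (u $ i)"]
        have "\<bar>?y $ i\<bar> = cmod (\<Sum>z\<in>S. c z * z ^ n * v z $ i)"
          by (simp add: cvec_def)
        also have "\<dots> \<le> (\<Sum>z\<in>S. cmod (c z) * \<rho> ^ n * cmod (v z $ i))"
          using le by (intro sum_norm_le)
            (auto simp: norm_mult norm_power intro!: mult_right_mono mult_left_mono power_mono)
        also have "\<dots> = C i * \<rho> ^ n"
          unfolding C_def sum_distrib_right by (intro sum.cong refl) (simp add: mult_ac)
        finally show ?thesis .
      qed
      then have "(\<Sum>i\<in>UNIV. \<bar>?y $ i\<bar>) \<le> (\<Sum>i\<in>UNIV. C i * \<rho> ^ n)" by (intro sum_mono)
      then show ?thesis using norm_le_l1_cart[of ?y] by (simp add: sum_distrib_right)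
    qed
    then show ?thesis by blast
  qed
  then show ?thesis using rate rate1 by blast
qed

text \<open>Otherwise \<open>R\<close> would be contracted, although \<open>M\<close> stretches it by \<open>l > 1\<close>.\<close>
lemma left_right_eigenvectors_not_orthogonal:
  fixes M :: "int^'a^'a::finite"
  assumes irr: "irreducible (char_polynomial M)"
    and L: "L \<noteq> 0" "L v* map_matrix real_of_int M = l *\<^sub>R L"
    and R: "R \<noteq> 0" "map_matrix real_of_int M *v R = l *\<^sub>R R"
    and l: "1 < l"
    and small: "\<And>z. is_eigenvalue (map_matrix complex_of_int M) z \<Longrightarrow> z \<noteq> of_real l \<Longrightarrow> cmod z < 1"
  shows "L \<bullet> R \<noteq> 0"
proof
  assume LR: "L \<bullet> R = 0"
  let ?A = "map_matrix real_of_int M"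
  obtain \<rho> C where \<rho>: "0 < \<rho>" "\<rho> < 1" "\<And>n. norm (((*v) ?A ^^ n) R) \<le> C * \<rho> ^ n"
    using contraction_on_hyperplane[OF irr L small] LR by blast
  have pow: "((*v) ?A ^^ n) R = l ^ n *\<^sub>R R" for n
    by (induction n) (simp_all add: R(2) matrix_vector_mult_scaleR mult.commute)
  have "norm R \<le> C * \<rho> ^ n" for n
  proof -
    have "norm R \<le> l ^ n * norm R" using l by (simp add: mult_le_cancel_right1)
    also have "\<dots> \<le> C * \<rho> ^ n" using \<rho>(3)[of n] l by (simp add: pow)
    finally show ?thesis .
  qed
  moreover have "(\<lambda>n. C * \<rho> ^ n) \<longlonglongrightarrow> C * 0"
    by (intro tendsto_mult_left LIMSEQ_power_zero) (use \<rho> in auto)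
  ultimately have "norm R \<le> C * 0" by (intro LIMSEQ_le_const[of "\<lambda>n. C * \<rho> ^ n"]) auto
  then show False using R(1) by simp
qed

lemma pf_projection_orthogonal: "L \<bullet> R \<noteq> 0 \<Longrightarrow> L \<bullet> pf_projection L R x = 0"
  by (simp add: pf_projection_def inner_diff_right)

lemma pf_projection_matrix:
  fixes A :: "real^'a^'a::finite"
  assumes "L v* A = l *\<^sub>R L" "A *v R = l *\<^sub>R R"
  shows "pf_projection L R (A *v x) = A *v pf_projection L R x"
proof -
  have "L \<bullet> (A *v x) = l * (L \<bullet> x)"
    using assms(1) by (metis dot_lmul_matrix inner_scaleR_left)
  then show ?thesis
    using assms(2) by (simp add: pf_projection_def matrix_vector_mult_diff_distrib matrix_vector_mult_scaleR)
qed

lemma projection_contraction: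
  fixes A :: "real^'a^'a::finite"
  assumes LR: "L \<bullet> R \<noteq> 0" and "0 < \<rho>"
    and decay: "\<And>x. L \<bullet> x = 0 \<Longrightarrow> \<exists>C. \<forall>n. norm (((*v) A ^^ n) x) \<le> C * \<rho> ^ n"
  shows "\<exists>C. \<forall>n x. norm (((*v) A ^^ n) (pf_projection L R x)) \<le> C * \<rho> ^ n * norm x"
proof -
  have "\<forall>j. \<exists>C. \<forall>n. norm (((*v) A ^^ n) (pf_projection L R (axis j 1))) \<le> C * \<rho> ^ n"
    using decay pf_projection_orthogonal[OF LR] by blast
  then obtain C where C: "\<And>j n. norm (((*v) A ^^ n) (pf_projection L R (axis j 1))) \<le> C j * \<rho> ^ n"
    by metis
  have lin: "linear (\<lambda>x. ((*v) A ^^ n) (pf_projection L R x))" for n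
  proof (induction n)
    case 0
    show ?case using pf_projection_characterization(1)[OF LR] by simp
  next
    case (Suc n)
    show ?case using linear_compose[OF Suc.IH matrix_vector_mul_linear[of A]] by (simp add: o_def)
  qed
  have "norm (((*v) A ^^ n) (pf_projection L R x)) \<le> (\<Sum>j\<in>UNIV. C j) * \<rho> ^ n * norm x" for n x
  proof -
    let ?f = "\<lambda>x. ((*v) A ^^ n) (pf_projection L R x)"
    have "?f x = ?f (\<Sum>j\<in>UNIV. (x $ j) *\<^sub>R axis j 1)"
      by (simp only: basis_expansion[of x, unfolded scalar_mult_eq_scaleR])
    also have "\<dots> = (\<Sum>j\<in>UNIV. (x $ j) *\<^sub>R ?f (axis j 1))"
      unfolding linear_sum[OF lin] linear_cmul[OF lin] ..
    also have "norm \<dots> \<le> (\<Sum>j\<in>UNIV. norm x * (C j * \<rho> ^ n))"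
      by (intro sum_norm_le) (simp add: mult_mono component_le_norm_cart C)
    also have "\<dots> = (\<Sum>j\<in>UNIV. C j) * \<rho> ^ n * norm x"
      unfolding sum_distrib_right by (intro sum.cong refl) (simp add: mult_ac)
    finally show ?thesis .
  qed
  then show ?thesis by blast
qed

section \<open>Primitive Pisot families\<close>

lemma abelianization_singleton: "abelianization [c] = axis c 1"
  by (auto simp: abelianization_def axis_def vec_eq_iff)

lemma abelianization_image_matrix:
  assumes "subst_matrix \<theta> = M"
  shows "abelianization (\<theta> c) = map_matrix real_of_int M *v abelianization [c]"
  unfolding abelianization_singleton matrix_vector_mult_basis
  by (simp add: assms[symmetric] abelianization_def column_def map_matrix_def subst_matrix_def vec_eq_iff)

text \<open>The matrix determines the length of the image of each letter.\<close>
lemma finite_compatible: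
  fixes \<Theta> :: "('a::finite \<Rightarrow> 'a list) set"
  assumes "\<And>\<theta>. \<theta> \<in> \<Theta> \<Longrightarrow> subst_matrix \<theta> = M"
  shows "finite \<Theta>"
proof -
  define N where "N c = (\<Sum>i\<in>UNIV. nat (M $ i $ c))" for c
  have "length (\<theta> c) = N c" if "\<theta> \<in> \<Theta>" for \<theta> c
  proof -
    have "count_list (\<theta> c) i = nat (M $ i $ c)" for i
      using assms[OF that] by (auto simp: subst_matrix_def)
    then show ?thesis using sum_count_set[of "\<theta> c" UNIV] by (simp add: N_def)
  qed
  then have "\<Theta> \<subseteq> (\<Pi>\<^sub>E c\<in>UNIV. {u. set u \<subseteq> UNIV \<and> length u = N c})" by auto
  moreover have "finite (\<Pi>\<^sub>E c\<in>UNIV. {u :: 'a list. set u \<subseteq> UNIV \<and> length u = N c})"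
    by (intro finite_PiE finite_lists_length_eq) auto
  ultimately show ?thesis by (rule finite_subset)
qed

lemma funpow_real_matrix:
  fixes M :: "int^'a^'a::finite"
  shows "((*v) (map_matrix real_of_int M) ^^ k) x = map_matrix real_of_int (((**) M ^^ k) (mat 1)) *v x"
proof (induction k)
  case 0
  have "map_matrix real_of_int (mat 1) = (mat 1 :: real^'a^'a)"
    by (simp add: map_matrix_def mat_def vec_eq_iff)
  then show ?case by simp
next
  case (Suc k)
  have "map_matrix real_of_int (M ** N) = map_matrix real_of_int M ** map_matrix real_of_int N" for N :: "int^'a^'a"
    by (simp add: map_matrix_def matrix_matrix_mult_def vec_eq_iff)
  then show ?case by (simp add: Suc matrix_vector_mul_assoc)
qed

text \<open>Positivity of the power gives every letter. If \<open>v\<close> has length one, then the alphabet has only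
  one letter and the power of \<open>A\<close> is the identity, which contradicts \<open>l > 1\<close>.\<close>
lemma (in substitution_family) primitive_imp_mixing:
  fixes M :: "int^'a^'a"
  assumes A: "A = map_matrix real_of_int M"
    and pos: "\<And>i j. (((**) M) ^^ k) (mat 1) $ i $ j > 0" and "1 \<le> k"
    and R: "R \<noteq> 0" "A *v R = l *\<^sub>R R" and l: "1 < l"
    and v: "v \<in> level k [b]"
  shows "c \<in> set v \<and> 2 \<le> length v"
proof -
  have mem: "c \<in> set v" for c
  proof -
    have "abelianization v $ c = real_of_int ((((**) M) ^^ k) (mat 1) $ c $ b)"
      unfolding abelianization_level[OF v] A funpow_real_matrix abelianization_singleton matrix_vector_mult_basis
      by (simp add: column_def map_matrix_def)
    then have "real (count_list v c) > 0" using pos[of c b] by (simp add: abelianization_def)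
    then show ?thesis by (simp add: count_list_0_iff) (metis count_list_0_iff less_irrefl)
  qed
  have "2 \<le> length v"
  proof (rule ccontr)
    assume "\<not> 2 \<le> length v"
    then have vb: "v = [b]" using mem[of b] by (cases v; cases "tl v") auto
    have all: "c = b" for c using mem[of c] vb by simp
    have R_eq: "R = (R $ b) *\<^sub>R abelianization [b]"
      unfolding abelianization_singleton vec_eq_iff by (metis all axis_nth mult.right_neutral real_scaleR_def vector_scaleR_component)
    have pow: "((*v) A ^^ n) (t *\<^sub>R x) = t *\<^sub>R ((*v) A ^^ n) x" for n t x
      by (induction n) (simp_all add: matrix_vector_mult_scaleR)
    have "((*v) A ^^ k) R = R"
      using abelianization_level[OF v] vb R_eq pow by metis
    moreover have "((*v) A ^^ n) R = l ^ n *\<^sub>R R" for n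
      by (induction n) (simp_all add: R(2) matrix_vector_mult_scaleR mult.commute)
    ultimately have "l ^ k *\<^sub>R R = 1 *\<^sub>R R" by simp
    then have "l ^ k = 1" using R(1) by (simp only: scaleR_cancel_right simp_thms)
    then show False using one_less_power[OF l, of k] \<open>1 \<le> k\<close> by simp
  qed
  then show ?thesis using mem by blast
qed

theorem theorem6p3:
  fixes \<Theta> :: "('a::finite \<Rightarrow> 'a list) set"
    and M :: "int^'a^'a"
    and L R :: "real^'a"
    and a :: 'a
  assumes "compatible \<Theta>"
    and "\<And>\<theta>. \<theta> \<in> \<Theta> \<Longrightarrow> subst_matrix \<theta> = M"
    and "primitive_matrix M"
    and "irreducible_pisot M"
    and "left_pf_eigenvector M L"
    and "right_pf_eigenvector M R"
  shows "(\<Union>\<theta>\<in>(UNIV :: nat set) \<rightarrow> \<Theta>. sadic_subtile L R \<theta> a) = rsubst_subtile L R (enveloping \<Theta>) a"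
proof -
  let ?A = "map_matrix real_of_int M"
  obtain l where l: "pf_eigenvalue M l" "pisot_number l" and irr: "irreducible (char_polynomial M)"
    using assms(4) unfolding irreducible_pisot_def by blast
  have l1: "1 < l" using l(2) by (simp add: pisot_number_def)
  have L: "L \<noteq> 0" "L v* ?A = l *\<^sub>R L"
    using assms(5) pf_eigenvalue_unique[OF l(1)] unfolding left_pf_eigenvector_def by auto
  have R: "R \<noteq> 0" "?A *v R = l *\<^sub>R R"
    using assms(6) pf_eigenvalue_unique[OF l(1)] unfolding right_pf_eigenvector_def by auto
  have small: "cmod z < 1" if "is_eigenvalue (map_matrix complex_of_int M) z" "z \<noteq> of_real l" for z
  proof -
    have "is_eigenvalue (map_matrix complex_of_int M) (of_real l)"
      using l(1) eigenvalue_complexification unfolding pf_eigenvalue_def by blast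
    then show ?thesis using pisot_other_eigenvalues[OF irr l(2) _ that] by blast
  qed
  have LR: "L \<bullet> R \<noteq> 0"
    by (rule left_right_eigenvectors_not_orthogonal[OF irr L R l1 small])
  obtain \<rho> where \<rho>: "0 < \<rho>" "\<rho> < 1"
    "\<And>x. L \<bullet> x = 0 \<Longrightarrow> \<exists>C. \<forall>n. norm (((*v) ?A ^^ n) x) \<le> C * \<rho> ^ n"
    using contraction_on_hyperplane[OF irr L small] by blast
  obtain C where C: "\<And>n x. norm (((*v) ?A ^^ n) (pf_projection L R x)) \<le> C * \<rho> ^ n * norm x"
    using projection_contraction[OF LR \<rho>(1) \<rho>(3)] by blast
  obtain k where k: "1 \<le> k" "\<And>i j. (((**) M) ^^ k) (mat 1) $ i $ j > 0"
    using assms(3) unfolding primitive_matrix_def by blast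
  interpret substitution_family \<Theta> ?A
  proof
    show "\<Theta> \<noteq> {}" using assms(1) by (simp add: compatible_def)
    show "finite \<Theta>" by (rule finite_compatible[OF assms(2)])
    show "\<theta> c \<noteq> []" if "\<theta> \<in> \<Theta>" for \<theta> c
      using assms(1) that by (simp add: compatible_def is_substitution_def)
    show "abelianization (\<theta> c) = ?A *v abelianization [c]" if "\<theta> \<in> \<Theta>" for \<theta> c
      by (rule abelianization_image_matrix[of \<theta>, OF assms(2)[OF that]])
  qed
  interpret contracting_family \<Theta> ?A k L R C \<rho>
  proof
    show "c \<in> set v \<and> 2 \<le> length v" if "v \<in> level k [b]" for v b c
      by (rule primitive_imp_mixing[OF refl k(2,1) R l1 that])
  qed (use LR \<rho>(1,2) C pf_projection_matrix[OF L(2) R(2)] in auto)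
  show ?thesis by (rule Union_sadic_subtiles)
qed

end
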